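(* Let $R$ be a one-dimensional complete local domain as in the context, with embedding dimension $n$ and conductor $\mathfrak{C}_R\subseteq\mathfrak{m}_R^2$. Suppose that $R$ is of reduced type one (i.e. $\dim_k\frac{(\mathfrak{C}_R,x_1)}{(x_1)}=1$) and that $\operatorname{type}(R)\leq\binom{n}{2}-2n$. If $\mathfrak{m}_R^5\subseteq\mathfrak{C}_R+x_1R$, then $\tau(\Omega_R)\neq 0$.
   Context: $k$ is an algebraically closed field of characteristic $0$; $(R,\mathfrak{m}_R,k)$ is a one-dimensional complete equicharacteristic local $k$-algebra which is a domain, with residue field $k$, fraction field $Q$, integral closure $\overline{R}=k[[t]]$ and embedding dimension $n$. Write $R=k[[x_1,\dots,x_n]]$ with $x_i=\alpha_it^{a_i}$ minimal generators of $\mathfrak{m}_R$, $\alpha_i$ units of $\overline{R}$, $\alpha_1=1$ (achieved by choice of $t$), $a_1\le\cdots\le a_n$. The conductor is $\mathfrak{C}_R=\{q\in Q:q\overline{R}\subseteq R\}$. $\operatorname{type}(R)$ is the Cohen-Macaulay type of $R$. Write $R=k[[X_1,\dots,X_n]]/I$ with $I=(f_1,\dots,f_m)\subseteq (X_1,\dots,X_n)^2$, $X_i\mapsto x_i$. The universally finite module of differentials $\Omega_R$ is the cokernel of the Jacobian matrix $R^m\xrightarrow{[\partial f_j/\partial x_i]}R^n$; $\tau(\Omega_R)$ is its torsion submodule. *)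

theory Defs
  imports
    "HOL-Library.Extended_Nat"
    "HOL-Library.FuncSet"
    "HOL-Library.Multiset"
    "HOL-Computational_Algebra.Computational_Algebra"
    "HOL-Algebra.Embedded_Algebras"
    "HOL-Algebra.Ideal_Product"
    "HOL-Algebra.Module"
    "HOL-Algebra.QuotRing"
    "HOL-Algebra.Ring_Divisibility"
begin

section \<open>Commutative algebra for rings with carriers\<close>

text \<open>The library makes the ideals of a ring a commutative semiring under the ideal product,
  with unit the whole ring; powers of ideals are the powers taken there.\<close>

abbreviation ideal_pow :: "('a, 'b) ring_scheme \<Rightarrow> 'a set \<Rightarrow> nat \<Rightarrow> 'a set" where
  "ideal_pow R I k \<equiv> I [^]\<^bsub>ideals_set R\<^esub> k"

definition local_with :: "('a, 'b) ring_scheme \<Rightarrow> 'a set \<Rightarrow> bool" where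
  "local_with R \<mm> \<longleftrightarrow> (\<forall>M. maximalideal M R \<longleftrightarrow> M = \<mm>)"

definition krull_dim :: "('a, 'b) ring_scheme \<Rightarrow> enat" where
  "krull_dim R = Sup {enat d |d. \<exists>P. (\<forall>i\<le>d. primeideal (P i) R) \<and> (\<forall>i<d. P i \<subset> P (Suc i))}"

text \<open>Bijectivity of the map from \<open>R\<close> to the inverse limit of the \<open>R / I^k\<close>,
  i.e. \<open>I\<close>-adic separatedness and convergence of Cauchy sequences.\<close>

definition adic_complete :: "('a, 'b) ring_scheme \<Rightarrow> 'a set \<Rightarrow> bool" where
  "adic_complete R I \<longleftrightarrow>
     (\<Inter>k. ideal_pow R I k) = {\<zero>\<^bsub>R\<^esub>} \<and>
     (\<forall>s. (\<forall>k. s k \<in> carrier R \<and> s (Suc k) \<ominus>\<^bsub>R\<^esub> s k \<in> ideal_pow R I k) \<longrightarrow>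
          (\<exists>l\<in>carrier R. \<forall>k. s k \<ominus>\<^bsub>R\<^esub> l \<in> ideal_pow R I k))"

text \<open>In the module records below, the fields \<open>mult\<close> and \<open>one\<close> play no role
  (the locale \<open>module\<close> does not refer to them).\<close>

definition free_module :: "('a, 'b) ring_scheme \<Rightarrow> nat \<Rightarrow> ('a, nat \<Rightarrow> 'a) module" where
  "free_module R n =
     \<lparr>carrier = {1..n} \<rightarrow>\<^sub>E carrier R, mult = undefined, one = undefined,
      zero = (\<lambda>i\<in>{1..n}. \<zero>\<^bsub>R\<^esub>), add = (\<lambda>u v. \<lambda>i\<in>{1..n}. u i \<oplus>\<^bsub>R\<^esub> v i),
      smult = (\<lambda>r v. \<lambda>i\<in>{1..n}. r \<otimes>\<^bsub>R\<^esub> v i)\<rparr>"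

definition quotient_module :: "('a, 'b, 'c) module_scheme \<Rightarrow> 'b set \<Rightarrow> ('a, 'b set) module" where
  "quotient_module M N =
     \<lparr>carrier = a_rcosets\<^bsub>M\<^esub> N, mult = undefined, one = undefined,
      zero = N, add = set_add M,
      smult = (\<lambda>r A. \<Union>v\<in>A. N +>\<^bsub>M\<^esub> (r \<odot>\<^bsub>M\<^esub> v))\<rparr>"

definition torsion :: "('a, 'b) ring_scheme \<Rightarrow> ('a, 'c, 'd) module_scheme \<Rightarrow> 'c set" where
  "torsion R M = {z \<in> carrier M. \<exists>r\<in>carrier R. r \<noteq> \<zero>\<^bsub>R\<^esub> \<and> r \<odot>\<^bsub>M\<^esub> z = \<zero>\<^bsub>M\<^esub>}"


section \<open>Formal power series in the variables \<open>X\<^sub>1, \<dots>, X\<^sub>n\<close>\<close>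

text \<open>As in \<open>HOL-Algebra.Indexed_Polynomials\<close>, a monomial is the multiset of its variables;
  a power series is the family of its coefficients.\<close>

type_synonym 'k mps = "nat multiset \<Rightarrow> 'k"

definition mps_ring :: "nat \<Rightarrow> 'k::field mps ring" where
  "mps_ring n =
     \<lparr>carrier = {f. \<forall>e. f e \<noteq> 0 \<longrightarrow> set_mset e \<subseteq> {1..n}},
      mult = (\<lambda>f g e. \<Sum>d | d \<subseteq># e. f d * g (e - d)),
      one = (\<lambda>e. if e = {#} then 1 else 0),
      zero = (\<lambda>e. 0),
      add = (\<lambda>f g e. f e + g e)\<rparr>"

definition mps_var :: "nat \<Rightarrow> 'k::field mps" where
  "mps_var i = (\<lambda>e. if e = {#i#} then 1 else 0)"

definition mps_pderiv :: "nat \<Rightarrow> 'k::field mps \<Rightarrow> 'k mps" where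
  "mps_pderiv i f = (\<lambda>e. of_nat (Suc (count e i)) * f (add_mset i e))"

text \<open>The value \<open>f(x\<^sub>1, \<dots>, x\<^sub>n)\<close> for \<open>x\<^sub>1, \<dots>, x\<^sub>n \<in> t k[[t]]\<close>. Under this condition
  monomials of degree greater than \<open>N\<close> do not contribute to the coefficient of \<open>t^N\<close>, so that
  the sum below may be cut off at degree \<open>N\<close>.\<close>

definition mps_eval :: "nat \<Rightarrow> (nat \<Rightarrow> 'k::field fps) \<Rightarrow> 'k mps \<Rightarrow> 'k fps" where
  "mps_eval n x f = Abs_fps (\<lambda>N.
     \<Sum>e | set_mset e \<subseteq> {1..n} \<and> size e \<le> N. f e * fps_nth (\<Prod>i\<in>#e. x i) N)"


section \<open>Subrings of \<open>k[[t]]\<close> with integral closure \<open>k[[t]]\<close>\<close>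

text \<open>The one-dimensional ring \<open>R\<close> is given by its carrier \<open>S \<subseteq> k[[t]]\<close>. Its fraction field and
  its integral closure are formed inside the field \<open>k((t))\<close> of Laurent series.\<close>

definition fps_ring :: "'k::field fps set \<Rightarrow> 'k fps ring" where
  "fps_ring S = \<lparr>carrier = S, mult = (*), one = 1, zero = 0, add = (+)\<rparr>"

definition frac_field :: "'k::field fps set \<Rightarrow> 'k fls set" where
  "frac_field S = {fps_to_fls a / fps_to_fls b |a b. a \<in> S \<and> b \<in> S \<and> b \<noteq> 0}"

definition integral_closure :: "'k::field fps set \<Rightarrow> 'k fls set" where
  "integral_closure S = {q \<in> frac_field S. \<exists>p :: 'k fls poly.
     lead_coeff p = 1 \<and> (\<forall>i. Polynomial.coeff p i \<in> fps_to_fls ` S) \<and> poly p q = 0}"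

text \<open>The elements \<open>q\<close> of the conductor lie in \<open>R\<close> because \<open>q = q \<cdot> 1\<close>; hence nothing is lost by
  taking the preimage in \<open>k[[t]]\<close>.\<close>

definition conductor :: "'k::field fps set \<Rightarrow> 'k fps set" where
  "conductor S = fps_to_fls -`
     {q \<in> frac_field S. \<forall>g\<in>integral_closure S. q * g \<in> fps_to_fls ` S}"

definition complete_local_curve :: "'k::field fps set \<Rightarrow> 'k fps set \<Rightarrow> bool" where
  "complete_local_curve S \<mm> \<longleftrightarrow>
     subring S (fps_ring UNIV) \<and>
     range fps_const \<subseteq> S \<and>
     noetherian_domain (fps_ring S) \<and>
     local_with (fps_ring S) \<mm> \<and>
     adic_complete (fps_ring S) \<mm> \<and>
     bij_betw (\<lambda>c. \<mm> +>\<^bsub>fps_ring S\<^esub> fps_const c) UNIV (carrier (fps_ring S Quot \<mm>)) \<and>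
     krull_dim (fps_ring S) = 1 \<and>
     integral_closure S = range fps_to_fls"

text \<open>\<open>dim\<^sub>k(J / I) = d\<close>, for a \<open>k\<close>-subspace \<open>J / I\<close> of the \<open>k\<close>-algebra \<open>R / I\<close>, where \<open>J\<close> is
  a set of representatives and \<open>k\<close> is identified with its image in \<open>R / I\<close>.\<close>

definition quotient_dim :: "'k::field fps set \<Rightarrow> 'k fps set \<Rightarrow> 'k fps set \<Rightarrow> nat \<Rightarrow> bool" where
  "quotient_dim S J I d \<longleftrightarrow>
     ring.dimension (fps_ring S Quot I) d
       ((\<lambda>c. I +>\<^bsub>fps_ring S\<^esub> fps_const c) ` UNIV)
       ((\<lambda>a. I +>\<^bsub>fps_ring S\<^esub> a) ` J)"

definition embedding_dim :: "'k::field fps set \<Rightarrow> 'k fps set \<Rightarrow> nat \<Rightarrow> bool" where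
  "embedding_dim S \<mm> n \<longleftrightarrow> quotient_dim S \<mm> (ideal_pow (fps_ring S) \<mm> 2) n"

text \<open>The Cohen-Macaulay type of the one-dimensional domain \<open>R\<close>: the \<open>k\<close>-dimension of the socle
  \<open>(xR : \<mm>) / xR\<close> of \<open>R / xR\<close>, which is the same for all parameters, i.e. for all
  nonzero \<open>x \<in> \<mm>\<close>.\<close>

definition cm_type :: "'k::field fps set \<Rightarrow> 'k fps set \<Rightarrow> nat \<Rightarrow> bool" where
  "cm_type S \<mm> r \<longleftrightarrow> (\<forall>x\<in>\<mm>. x \<noteq> 0 \<longrightarrow>
     quotient_dim S {a \<in> S. \<forall>b\<in>\<mm>. a * b \<in> PIdl\<^bsub>fps_ring S\<^esub> x} (PIdl\<^bsub>fps_ring S\<^esub> x) r)"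

text \<open>\<open>R = k[[X\<^sub>1, \<dots>, X\<^sub>n]] / I\<close> via \<open>X\<^sub>i \<mapsto> x\<^sub>i\<close>, with \<open>I = (f\<^sub>1, \<dots>, f\<^sub>m) \<subseteq> (X\<^sub>1, \<dots>, X\<^sub>n)\<^sup>2\<close>.\<close>

definition presentation ::
    "'k::field fps set \<Rightarrow> nat \<Rightarrow> (nat \<Rightarrow> 'k fps) \<Rightarrow> nat \<Rightarrow> (nat \<Rightarrow> 'k mps) \<Rightarrow> bool" where
  "presentation S n x m f \<longleftrightarrow>
     mps_eval n x ` carrier (mps_ring n) = S \<and>
     f ` {1..m} \<subseteq> carrier (mps_ring n) \<and>
     Idl\<^bsub>mps_ring n\<^esub> (f ` {1..m}) = a_kernel (mps_ring n) (fps_ring S) (mps_eval n x) \<and>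
     Idl\<^bsub>mps_ring n\<^esub> (f ` {1..m}) \<subseteq>
       ideal_pow (mps_ring n) (Idl\<^bsub>mps_ring n\<^esub> (mps_var ` {1..n})) 2"

definition jacobian_map ::
    "nat \<Rightarrow> (nat \<Rightarrow> 'k::field fps) \<Rightarrow> nat \<Rightarrow> (nat \<Rightarrow> 'k mps) \<Rightarrow> (nat \<Rightarrow> 'k fps) \<Rightarrow> nat \<Rightarrow> 'k fps" where
  "jacobian_map n x m f c =
     (\<lambda>i\<in>{1..n}. \<Sum>j\<in>{1..m}. mps_eval n x (mps_pderiv i (f j)) * c j)"

definition differentials ::
    "'k::field fps set \<Rightarrow> nat \<Rightarrow> (nat \<Rightarrow> 'k fps) \<Rightarrow> nat \<Rightarrow> (nat \<Rightarrow> 'k mps)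
      \<Rightarrow> ('k fps, (nat \<Rightarrow> 'k fps) set) module" where
  "differentials S n x m f =
     quotient_module (free_module (fps_ring S) n)
       (jacobian_map n x m f ` carrier (free_module (fps_ring S) m))"

end

theory Submission
  imports Defs
begin

text \<open>If the torsion vanishes, \<open>\<Omega>\<^sub>R\<close> is the module \<open>D = \<Sum> R \<delta>x\<^sub>i \<subseteq> k[[t]]\<close> with \<open>\<delta> = t d/dt\<close>, and every
  syzygy of the \<open>\<delta>x\<^sub>i\<close> is the gradient of a relation. With \<open>x\<^sub>1 = t\<^sup>e\<close>, both \<open>R / x\<^sub>1R\<close> and \<open>D / x\<^sub>1D\<close>
  have dimension \<open>e\<close>. Consider an element \<open>\<Sum> \<lambda>\<^sub>i\<^sub>j x\<^sub>i \<delta>x\<^sub>j - \<delta>h - c \<delta>x\<^sub>1\<close>, the sum running over \<open>2 \<le> i < j\<close>, which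
  lies in \<open>x\<^sub>1D\<close>. The symmetry of second derivatives forces \<open>\<lambda> = 0\<close>, and the Euler operator forces \<open>h\<close>
  into \<open>\<mm>\<^sup>4 + x\<^sub>1R\<close>. Since the conductor, hence \<open>\<mm>\<^sup>5\<close>, is at most one-dimensional modulo \<open>x\<^sub>1R\<close>, a further \<open>n - 1\<close> linear
  conditions put \<open>h\<close> into the socle modulo \<open>x\<^sub>1R\<close>, and \<open>r\<close> more into \<open>x\<^sub>1R\<close>. Hence
  \<open>binomial(n - 1, 2) + e\<close> unknowns are determined by \<open>e + (n - 1) + r\<close> equations, whereas
  the hypothesis on \<open>r\<close> makes the former number larger.\<close>

section \<open>Linear algebra\<close>

text \<open>Using \<delta> instead of d/dt multiplies D by t. Every element of D then has zero
  constant term, so \<delta>x_1 = e t^e lies outside x_1D. The pairs 2 \<le> i < j are what remains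
  after discarding products that are exact modulo x_1D: x_1 \<delta>x_j is in x_1D, x_i \<delta>x_1
  differs from \<delta>(x_1 x_i) by such an element, and x_j \<delta>x_i differs from - x_i
  \<delta>x_j by \<delta>(x_i x_j). The exponent 5 arises as follows. Once \<lambda> = 0, a lift of
  h has no terms of degree below three outside the multiples of X_1. The Euler operator can cancel
  one further degree, the third. So h has order four modulo x_1, and each x_i h has order five. The
  conditions on h acquire their meaning only after \<lambda> = 0 is known, but all conditions are
  linear in the unknowns, so they are imposed simultaneously and interpreted one after the other.
  Numerically, r \<le> binom(n, 2) - 2n reads (n - 1) + r \<le> binom(n - 1, 2) - 2, so the unknowns
  exceed the equations by at least two; e cancels.\<close>

lemma underdetermined_system:
  fixes A :: "'i \<Rightarrow> 'j \<Rightarrow> 'a::field"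
  assumes "finite I" "finite J" "card I < card J"
  shows "\<exists>c. (\<exists>j\<in>J. c j \<noteq> 0) \<and> (\<forall>i\<in>I. (\<Sum>j\<in>J. A i j * c j) = 0)"
  using assms
proof (induction I arbitrary: J A rule: finite_induct)
  case empty
  then obtain j where "j \<in> J"
    by (metis card.empty less_irrefl ex_in_conv)
  then show ?case
    by (intro exI[of _ "\<lambda>_. 1"]) auto
next
  case (insert i I)
  show ?case
  proof (cases "\<forall>j\<in>J. A i j = 0")
    case True
    have "card I < card J"
      using insert by simp
    from insert.IH[OF insert.prems(1) this, of A]
    obtain c where "\<exists>j\<in>J. c j \<noteq> 0" "\<forall>i\<in>I. (\<Sum>j\<in>J. A i j * c j) = 0"
      by blast
    with True show ?thesis
      by (intro exI[of _ c]) simp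
  next
    case False
    then obtain p where p: "p \<in> J" "A i p \<noteq> 0"
      by blast
    have "finite (J - {p})" "card I < card (J - {p})"
      using insert p by auto
    \<comment> \<open>Gaussian elimination with pivot \<open>A i p\<close>: this is the matrix of
      the other equations after equation \<open>i\<close> has been solved for the unknown
      \<open>p\<close>, whose value is \<open>q\<close> below.\<close>
    from insert.IH[OF this, of "\<lambda>i' j. A i' j - A i' p * A i j / A i p"]
    obtain c where c: "\<exists>j\<in>J - {p}. c j \<noteq> 0"
      "\<And>i'. i' \<in> I \<Longrightarrow> (\<Sum>j\<in>J - {p}. (A i' j - A i' p * A i j / A i p) * c j) = 0"
      by blast
    define q where "q = - (\<Sum>j\<in>J - {p}. A i j * c j) / A i p"
    define c' where "c' = c(p := q)"
    have split: "(\<Sum>j\<in>J. A i' j * c' j) = A i' p * q + (\<Sum>j\<in>J - {p}. A i' j * c j)" for i'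
      using p(1) insert.prems(1) by (simp add: sum.remove c'_def)
    have "(\<Sum>j\<in>J. A i j * c' j) = 0"
      unfolding split q_def using p(2) by simp
    moreover have "(\<Sum>j\<in>J. A i' j * c' j) = 0" if "i' \<in> I" for i'
    proof -
      have "0 = (\<Sum>j\<in>J - {p}. A i' j * c j) - (\<Sum>j\<in>J - {p}. A i' p / A i p * (A i j * c j))"
        using c(2)[OF that] by (simp add: algebra_simps sum_subtractf)
      also have "\<dots> = (\<Sum>j\<in>J - {p}. A i' j * c j) + A i' p * q"
        by (simp add: q_def sum_distrib_left sum_divide_distrib)
      finally show ?thesis
        unfolding split by (simp add: add.commute)
    qed
    ultimately show ?thesis
      using c(1) by (intro exI[of _ c']) (auto simp: c'_def)
  qed
qed

text \<open>A basis of \<open>W\<close>, enlarged by \<open>b\<close> if \<open>b\<close> is outside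
  \<open>W\<close>, extends to a basis of the whole space; the coordinate at \<open>b\<close>
  vanishes on \<open>W\<close>.\<close>

lemma (in vector_space) separating_functional:
  assumes "subspace W"
  shows "\<exists>\<phi>. Vector_Spaces.linear scale (*) \<phi> \<and> (\<forall>w\<in>W. \<phi> w = 0) \<and> (b \<notin> W \<longrightarrow> \<phi> b = 1)"
proof (cases "b \<in> W")
  case True
  interpret pair: vector_space_pair scale "(*) :: 'a \<Rightarrow> 'a \<Rightarrow> 'a"
    by unfold_locales (auto simp: algebra_simps)
  from True show ?thesis
    by (intro exI[of _ "\<lambda>_. 0"]) (simp add: pair.linear_zero)
next
  case False
  obtain B where B: "B \<subseteq> W" "independent B" "W \<subseteq> span B"
    using maximal_independent_subset by blast
  have span: "span B = W"
    using B assms span_minimal by blast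
  define E where "E = extend_basis (insert b B)"
  have ind: "independent (insert b B)"
    using False span B(2) by (intro independent_insertI) auto
  have E: "insert b B \<subseteq> E" "independent E" "span E = UNIV"
    unfolding E_def using ind extend_basis_superset independent_extend_basis span_extend_basis
    by auto
  have "representation E w b = 0" if "w \<in> W" for w
  proof -
    have "representation E w = representation B w"
      using that span E by (intro representation_extend) auto
    then show ?thesis
      using representation_ne_zero[of B w b] False B by auto
  qed
  moreover have "representation E b b = 1"
    using E by (simp add: representation_basis)
  moreover have "Vector_Spaces.linear scale (*) (\<lambda>v. representation E v b)"
    using linear_representation[OF E(2,3)] .
  ultimately show ?thesis
    by blast
qed

text \<open>This turns a bound \<open>d\<close> on a dimension modulo \<open>W\<close> into
  \<open>d\<close> linear equations; the vectors \<open>b i\<close> may be dependent modulo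
  \<open>W\<close>. The induction enlarges \<open>W\<close> by the line through \<open>b d\<close>:
  the first \<open>d\<close> functionals bring the vector into the larger space, and one more
  functional, vanishing on \<open>W\<close>, brings it into \<open>W\<close>.\<close>

lemma (in vector_space) separating_functionals:
  fixes b :: "nat \<Rightarrow> 'b"
  assumes "subspace W"
  shows "\<exists>\<phi>. (\<forall>i. Vector_Spaces.linear scale (*) (\<phi> i)) \<and>
    (\<forall>c w. w \<in> W \<longrightarrow> (\<forall>i<d. \<phi> i ((\<Sum>i<d. scale (c i) (b i)) + w) = 0) \<longrightarrow>
      (\<Sum>i<d. scale (c i) (b i)) + w \<in> W)"
  using assms
proof (induction d arbitrary: W)
  case 0
  obtain \<phi> where "Vector_Spaces.linear scale (*) \<phi>"
    using separating_functional[OF 0] by blast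
  then show ?case
    by (intro exI[of _ "\<lambda>_. \<phi>"]) simp
next
  case (Suc d)
  define W' where "W' = {v. \<exists>k. v - scale k (b d) \<in> W}"
  have W': "W' = span (insert (b d) W)"
    unfolding W'_def span_insert span_eq_iff[THEN iffD2, OF Suc.prems] ..
  obtain \<phi> where \<phi>: "\<And>i. Vector_Spaces.linear scale (*) (\<phi> i)"
    "\<And>c w. w \<in> W' \<Longrightarrow> \<forall>i<d. \<phi> i ((\<Sum>i<d. scale (c i) (b i)) + w) = 0 \<Longrightarrow>
      (\<Sum>i<d. scale (c i) (b i)) + w \<in> W'"
    using Suc.IH[of W'] W' by auto
  obtain \<psi> where \<psi>: "Vector_Spaces.linear scale (*) \<psi>" "\<And>w. w \<in> W \<Longrightarrow> \<psi> w = 0"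
    "b d \<notin> W \<Longrightarrow> \<psi> (b d) = 1"
    using separating_functional[OF Suc.prems, of "b d"] by blast
  interpret \<psi>: Vector_Spaces.linear scale "(*)" \<psi>
    by (fact \<psi>(1))
  define \<phi>' where "\<phi>' = \<phi>(d := \<psi>)"
  have "(\<Sum>i<Suc d. scale (c i) (b i)) + w \<in> W"
    if w: "w \<in> W" and 0: "\<forall>i<Suc d. \<phi>' i ((\<Sum>i<Suc d. scale (c i) (b i)) + w) = 0" for c w
  proof -
    define v where "v = (\<Sum>i<Suc d. scale (c i) (b i)) + w"
    define w' where "w' = scale (c d) (b d) + w"
    have v: "v = (\<Sum>i<d. scale (c i) (b i)) + w'"
      by (simp add: v_def w'_def add.assoc)
    have "w' \<in> W'"
      using w unfolding W'_def w'_def by (auto intro!: exI[of _ "c d"])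
    moreover have "\<forall>i<d. \<phi> i v = 0"
      using 0 unfolding v_def[symmetric] \<phi>'_def by (metis fun_upd_other less_SucI less_irrefl)
    ultimately have "v \<in> W'"
      using \<phi>(2) unfolding v by blast
    then obtain k where k: "v - scale k (b d) \<in> W"
      unfolding W'_def by blast
    have "\<psi> v = 0"
      using 0 unfolding v_def[symmetric] \<phi>'_def by auto
    moreover have "\<psi> (v - scale k (b d)) = \<psi> v - k * \<psi> (b d)"
      by (simp add: \<psi>.diff \<psi>.scale)
    ultimately have "b d \<in> W \<or> k = 0"
      using \<psi>(2)[OF k] \<psi>(3) by (cases "b d \<in> W") auto
    then have "scale k (b d) \<in> W"
      using Suc.prems by (auto simp: subspace_scale subspace_0)
    from subspace_add[OF Suc.prems k this] show ?thesis
      unfolding v_def[symmetric] by simp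
  qed
  moreover have "\<forall>i. Vector_Spaces.linear scale (*) (\<phi>' i)"
    using \<phi>(1) \<psi>(1) by (simp add: \<phi>'_def)
  ultimately show ?case
    by blast
qed

section \<open>The ring of power series\<close>

lemma finite_multisets_bounded:
  assumes "finite A"
  shows "finite {e. set_mset e \<subseteq> A \<and> size e \<le> N}"
proof -
  have "{e. set_mset e \<subseteq> A \<and> size e \<le> N} \<subseteq> mset ` {xs. set xs \<subseteq> A \<and> length xs \<le> N}"
  proof
    fix e assume "e \<in> {e. set_mset e \<subseteq> A \<and> size e \<le> N}"
    moreover obtain xs where "e = mset xs"
      using ex_mset by metis
    ultimately show "e \<in> mset ` {xs. set xs \<subseteq> A \<and> length xs \<le> N}"
      by auto
  qed
  then show ?thesis
    using finite_lists_length_le[OF assms] finite_surj by blast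
qed

lemma finite_submultisets [simp]: "finite {d. d \<subseteq># e}"
  by (rule finite_subset[OF _ finite_multisets_bounded[of "set_mset e" "size e"]])
    (auto dest: mset_subset_eqD size_mset_mono)

lemma diff_diff_submultiset: "d \<subseteq># e \<Longrightarrow> e - (e - d) = d"
  by (simp add: multiset_eq_iff subseteq_mset_def)

lemma sum_submultisets_swap:
  "(\<Sum>d | d \<subseteq># e. F d (e - d)) = (\<Sum>d | d \<subseteq># e. F (e - d) d)"
  by (rule sum.reindex_bij_witness[of _ "\<lambda>d. e - d" "\<lambda>d. e - d"])
    (auto simp: diff_diff_submultiset)

text \<open>Both sides run over the ordered decompositions of \<open>e\<close> into three parts,
  which is associativity of the convolution product.\<close>

lemma sum_submultisets_triple:
  "(\<Sum>d | d \<subseteq># e. \<Sum>c | c \<subseteq># d. F c (d - c) (e - d)) =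
   (\<Sum>c | c \<subseteq># e. \<Sum>b | b \<subseteq># e - c. F c b (e - c - b))"
proof -
  have "(\<Sum>(d, c)\<in>(SIGMA d:{d. d \<subseteq># e}. {c. c \<subseteq># d}). F c (d - c) (e - d)) =
    (\<Sum>(c, b)\<in>(SIGMA c:{c. c \<subseteq># e}. {b. b \<subseteq># e - c}). F c b (e - c - b))"
  proof (rule sum.reindex_bij_witness[of _ "\<lambda>(c, b). (c + b, c)" "\<lambda>(d, c). (c, d - c)"], goal_cases)
    case (1 p) then show ?case by auto
  next
    case (2 p) then show ?case
      by (auto simp: subseteq_mset_def) (meson diff_le_mono le_trans)+
  next
    case (3 p) then show ?case by auto
  next
    case (4 p) then show ?case
      by (auto simp: subseteq_mset_def)
        (metis Nat.le_diff_conv2 add.commute)+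
  next
    case (5 p) then show ?case
      by (auto simp: diff_diff_add_mset)
  qed
  then show ?thesis
    by (simp add: sum.Sigma)
qed

abbreviation mps_mult :: "'k::field mps \<Rightarrow> 'k mps \<Rightarrow> 'k mps" where
  "mps_mult f g \<equiv> (\<lambda>e. \<Sum>d | d \<subseteq># e. f d * g (e - d))"

abbreviation mps_carrier :: "nat \<Rightarrow> 'k::field mps set" where
  "mps_carrier n \<equiv> {f. \<forall>e. f e \<noteq> 0 \<longrightarrow> set_mset e \<subseteq> {1..n}}"

lemma mps_mult_commute: "mps_mult f g = mps_mult g f"
  by (rule ext, subst sum_submultisets_swap) (simp add: mult.commute)

lemma mps_mult_assoc: "mps_mult (mps_mult f g) h = mps_mult f (mps_mult g h)"
  by (rule ext)
    (simp add: sum_distrib_left sum_distrib_right mult.assoc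
      sum_submultisets_triple[of "\<lambda>a b c. f a * (g b * h c)"])

lemma mps_mult_closed:
  assumes "f \<in> mps_carrier n" "g \<in> mps_carrier n"
  shows "mps_mult f g \<in> mps_carrier n"
proof clarify
  fix e i assume "mps_mult f g e \<noteq> 0" and i: "i \<in># e"
  then obtain d where d: "d \<subseteq># e" "f d \<noteq> 0" "g (e - d) \<noteq> 0"
    by (metis (mono_tags, lifting) mem_Collect_eq mult_eq_0_iff sum.not_neutral_contains_not_neutral)
  have "i \<in># d + (e - d)"
    using i d(1) by simp
  then have "i \<in># d \<or> i \<in># e - d"
    by (meson union_iff)
  with d assms show "i \<in> {1..n}"
    by blast
qed

lemma mps_mult_one: "mps_mult (\<lambda>e. if e = {#} then 1 else 0) f = f"
proof
  fix e :: "nat multiset"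
  have "(\<Sum>d | d \<subseteq># e. (if d = {#} then 1 else 0) * f (e - d)) = (\<Sum>d\<in>{{#}}. f (e - d))"
    by (rule sum.mono_neutral_cong_right) auto
  then show "(\<Sum>d | d \<subseteq># e. (if d = {#} then 1 else 0) * f (e - d)) = f e"
    by simp
qed

lemma cring_mps_ring: "cring (mps_ring n :: 'k::field mps ring)"
proof (rule cringI)
  show "abelian_group (mps_ring n :: 'k mps ring)"
  proof (rule abelian_groupI)
    fix f :: "'k mps" assume "f \<in> carrier (mps_ring n)"
    then show "\<exists>g\<in>carrier (mps_ring n). g \<oplus>\<^bsub>mps_ring n\<^esub> f = \<zero>\<^bsub>mps_ring n\<^esub>"
      by (intro bexI[of _ "\<lambda>e. - f e"]) (auto simp: mps_ring_def)
  next
    fix f g :: "'k mps" assume "f \<in> carrier (mps_ring n)" "g \<in> carrier (mps_ring n)"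
    then show "f \<oplus>\<^bsub>mps_ring n\<^esub> g \<in> carrier (mps_ring n)"
      unfolding mps_ring_def by clarsimp (metis add.right_neutral add_0 subsetD atLeastAtMost_iff)
  qed (auto simp: mps_ring_def ac_simps)
  show "comm_monoid (mps_ring n :: 'k mps ring)"
  proof (rule comm_monoidI)
    fix f g h :: "'k mps"
    show "f \<otimes>\<^bsub>mps_ring n\<^esub> g \<otimes>\<^bsub>mps_ring n\<^esub> h = f \<otimes>\<^bsub>mps_ring n\<^esub> (g \<otimes>\<^bsub>mps_ring n\<^esub> h)"
      by (simp add: mps_ring_def mps_mult_assoc)
    show "f \<otimes>\<^bsub>mps_ring n\<^esub> g = g \<otimes>\<^bsub>mps_ring n\<^esub> f"
      using mps_mult_commute by (simp add: mps_ring_def)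
    show "\<one>\<^bsub>mps_ring n\<^esub> \<otimes>\<^bsub>mps_ring n\<^esub> f = f"
      using mps_mult_one[of f] by (simp add: mps_ring_def)
    assume "f \<in> carrier (mps_ring n)" "g \<in> carrier (mps_ring n)"
    then show "f \<otimes>\<^bsub>mps_ring n\<^esub> g \<in> carrier (mps_ring n)"
      using mps_mult_closed[of f n g] by (simp add: mps_ring_def)
  qed (simp add: mps_ring_def)
  fix f g h :: "'k mps"
  show "(f \<oplus>\<^bsub>mps_ring n\<^esub> g) \<otimes>\<^bsub>mps_ring n\<^esub> h = f \<otimes>\<^bsub>mps_ring n\<^esub> h \<oplus>\<^bsub>mps_ring n\<^esub> g \<otimes>\<^bsub>mps_ring n\<^esub> h"
    by (simp add: mps_ring_def distrib_right sum.distrib)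
qed

text \<open>The factor produced by the derivative is the multiplicity of \<open>i\<close> in
  \<open>e'\<close>, hence the sum of its multiplicities in \<open>d\<close> and
  \<open>e' - d\<close>. The first share is \<open>left\<close>; exchanging the two parts reduces
  the second share to it.\<close>

lemma mps_pderiv_mult:
  fixes f g :: "'k::field mps"
  shows "mps_pderiv i (mps_mult f g) = (\<lambda>e. mps_mult (mps_pderiv i f) g e + mps_mult f (mps_pderiv i g) e)"
proof
  fix e
  define e' where "e' = add_mset i e"
  have left: "(\<Sum>d | d \<subseteq># e'. of_nat (count d i) * f d * g (e' - d)) = mps_mult (mps_pderiv i f) g e"
    for f g :: "'k mps"
  proof -
    have "(\<Sum>d | d \<subseteq># e'. of_nat (count d i) * f d * g (e' - d)) =
      (\<Sum>d | d \<subseteq># e' \<and> i \<in># d. of_nat (count d i) * f d * g (e' - d))"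
      by (rule sum.mono_neutral_right) (auto simp: not_in_iff)
    also have "\<dots> = mps_mult (mps_pderiv i f) g e"
    proof (rule sum.reindex_bij_witness[of _ "add_mset i" "\<lambda>d. d - {#i#}"])
      fix d assume d: "d \<in> {d. d \<subseteq># e' \<and> i \<in># d}"
      then show "d - {#i#} \<in> {d. d \<subseteq># e}"
        by (auto simp: e'_def subset_eq_diff_conv)
      show "mps_pderiv i f (d - {#i#}) * g (e - (d - {#i#})) = of_nat (count d i) * f d * g (e' - d)"
        using d by (auto simp: mps_pderiv_def e'_def dest!: multi_member_split)
    qed (auto simp: e'_def)
    finally show ?thesis .
  qed
  have "mps_pderiv i (mps_mult f g) e =
    (\<Sum>d | d \<subseteq># e'. of_nat (count d i) * f d * g (e' - d) + f d * (of_nat (count (e' - d) i) * g (e' - d)))"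
    unfolding mps_pderiv_def sum_distrib_left e'_def[symmetric]
  proof (rule sum.cong)
    fix d assume "d \<in> {d. d \<subseteq># e'}"
    then have "count d i + count (e' - d) i = count e' i"
      by (simp add: mset_subset_eq_count)
    then have "Suc (count e i) = count d i + count (e' - d) i"
      by (simp add: e'_def)
    then have "(of_nat (Suc (count e i)) :: 'k) = of_nat (count d i) + of_nat (count (e' - d) i)"
      by (metis of_nat_add)
    then show "of_nat (Suc (count e i)) * (f d * g (e' - d)) =
        of_nat (count d i) * f d * g (e' - d) + f d * (of_nat (count (e' - d) i) * g (e' - d))"
      by (simp only: algebra_simps)
  qed simp
  also have "\<dots> = mps_mult (mps_pderiv i f) g e +
      (\<Sum>d | d \<subseteq># e'. f d * (of_nat (count (e' - d) i) * g (e' - d)))"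
    by (simp only: sum.distrib left)
  also have "(\<Sum>d | d \<subseteq># e'. f d * (of_nat (count (e' - d) i) * g (e' - d))) =
      (\<Sum>d | d \<subseteq># e'. of_nat (count d i) * g d * f (e' - d))"
    by (subst sum_submultisets_swap) (simp add: mult.commute)
  also have "\<dots> = mps_mult f (mps_pderiv i g) e"
    unfolding left by (fact fun_cong[OF mps_mult_commute])
  finally show "mps_pderiv i (mps_mult f g) e =
      mps_mult (mps_pderiv i f) g e + mps_mult f (mps_pderiv i g) e" .
qed

lemma mps_pderiv_closed: "f \<in> mps_carrier n \<Longrightarrow> mps_pderiv i f \<in> mps_carrier n"
  unfolding mps_pderiv_def
  by clarsimp (metis insert_subset set_mset_add_mset_insert subsetD atLeastAtMost_iff One_nat_def)

lemma (in cring) idealI':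
  assumes "I \<subseteq> carrier R" "\<zero> \<in> I" "\<And>a b. a \<in> I \<Longrightarrow> b \<in> I \<Longrightarrow> a \<oplus> b \<in> I"
    and mult: "\<And>a b. a \<in> I \<Longrightarrow> b \<in> carrier R \<Longrightarrow> b \<otimes> a \<in> I"
  shows "ideal I R"
proof (rule idealI)
  show "subgroup I (add_monoid R)"
  proof (rule add.subgroupI)
    fix a assume "a \<in> I"
    then have "\<ominus> a = (\<ominus> \<one>) \<otimes> a"
      using assms(1) l_minus[of \<one> a] by auto
    then show "\<ominus> a \<in> I"
      using mult[OF \<open>a \<in> I\<close>, of "\<ominus> \<one>"] by simp
  qed (use assms in auto)
  fix a b assume "a \<in> I" "b \<in> carrier R"
  then show "b \<otimes> a \<in> I" "a \<otimes> b \<in> I"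
    using mult[of a b] m_comm[of a b] assms(1) by auto
qed (rule ring_axioms)

lemma mps_mult_var: "mps_mult (mps_var i) F e = (if i \<in># e then F (e - {#i#}) else 0)"
proof -
  have "mps_mult (mps_var i) F e = (\<Sum>d | d \<subseteq># e \<and> d = {#i#}. F (e - d))"
    by (rule sum.mono_neutral_cong_right) (auto simp: mps_var_def)
  also have "{d. d \<subseteq># e \<and> d = {#i#}} = (if i \<in># e then {{#i#}} else {})"
    by auto
  finally show ?thesis
    by simp
qed

text \<open>Translates membership in the square of the ideal of the variables into coefficients: the
  elements of that ideal have no constant term, and a product of two such series starts in degree
  two.\<close>

lemma mps_order_two:
  assumes "F \<in> ideal_pow (mps_ring n) (Idl\<^bsub>mps_ring n\<^esub> (mps_var ` {1..n})) 2"
    and "size e < 2"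
  shows "F e = (0 :: 'k::field)"
proof -
  interpret cring "mps_ring n :: 'k mps ring"
    by (rule cring_mps_ring)
  define K :: "'k mps set" where "K = {F \<in> mps_carrier n. F {#} = 0}"
  have "ideal K (mps_ring n)"
  proof (rule idealI')
    fix f g :: "'k mps" assume "f \<in> K" "g \<in> K"
    then show "f \<oplus>\<^bsub>mps_ring n\<^esub> g \<in> K"
      using a_closed[of f g] by (auto simp: K_def mps_ring_def)
  next
    fix f g :: "'k mps" assume "f \<in> K" "g \<in> carrier (mps_ring n)"
    then show "g \<otimes>\<^bsub>mps_ring n\<^esub> f \<in> K"
      using m_closed[of g f] by (auto simp: K_def mps_ring_def)
  qed (auto simp: K_def mps_ring_def)
  moreover have "mps_var ` {1..n} \<subseteq> K"
    by (auto simp: K_def mps_var_def split: if_splits)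
  ultimately have gen: "Idl\<^bsub>mps_ring n\<^esub> (mps_var ` {1..n}) \<subseteq> K"
    by (rule genideal_minimal)
  have prod: "s {#} = 0" if "s \<in> ideal_prod (mps_ring n) A B" "B \<subseteq> K" for A B s
    using that by (induction s rule: ideal_prod.induct) (auto simp: mps_ring_def K_def)
  have prod2: "s e = 0" if "s \<in> ideal_prod (mps_ring n) A B" "\<forall>a\<in>A. a {#} = 0" "B \<subseteq> K" for A B s
    using that
  proof (induction s rule: ideal_prod.induct)
    case (prod a b)
    have "a d * b (e - d) = 0" if "d \<subseteq># e" for d
    proof (cases "d = {#} \<or> e - d = {#}")
      case False
      then have "size d \<noteq> 0" "size (e - d) \<noteq> 0"
        by auto
      moreover have "size d + size (e - d) = size e"
        using that by (metis size_union subset_mset.add_diff_inverse)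
      ultimately show ?thesis
        using assms(2) by linarith
    qed (use prod in \<open>auto simp: K_def\<close>)
    then have "mps_mult a b e = 0"
      by (intro sum.neutral) auto
    then show ?case
      by (simp add: mps_ring_def)
  qed (simp add: mps_ring_def)
  \<comment> \<open>The square unfolds to a product of three factors, the first being the unit
    ideal. Hence \<open>prod\<close> handles the inner product and \<open>prod2\<close> the outer
    one.\<close>
  have "F \<in> ideal_prod (mps_ring n) (ideal_prod (mps_ring n) (carrier (mps_ring n))
      (Idl\<^bsub>mps_ring n\<^esub> (mps_var ` {1..n}))) (Idl\<^bsub>mps_ring n\<^esub> (mps_var ` {1..n}))"
    using assms(1) by (simp add: numeral_2_eq_2 ideals_set_def)
  then show ?thesis
    by (rule prod2) (use prod gen in blast)+
qed

section \<open>Substitution of series without constant term, and the chain rule\<close>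

locale mps_evaluation =
  fixes n :: nat and x :: "nat \<Rightarrow> 'k::field fps"
  assumes x_nth_0: "\<And>i. i \<in> {1..n} \<Longrightarrow> x i $ 0 = 0"
begin

abbreviation ev :: "'k mps \<Rightarrow> 'k fps" where
  "ev \<equiv> mps_eval n x"

definition monomials :: "nat \<Rightarrow> nat multiset set" where
  "monomials N = {e. set_mset e \<subseteq> {1..n} \<and> size e \<le> N}"

lemma mem_monomials: "e \<in> monomials N \<longleftrightarrow> set_mset e \<subseteq> {1..n} \<and> size e \<le> N"
  by (simp add: monomials_def)

lemma submultiset_monomials:
  assumes "e \<in> monomials N" "d \<subseteq># e"
  shows "d \<in> monomials N"
  using assms set_mset_mono[OF assms(2)] size_mset_mono[OF assms(2)]
  unfolding mem_monomials by (meson le_trans subset_trans)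

definition mon :: "nat multiset \<Rightarrow> 'k fps" where
  "mon e = (\<Prod>i\<in>#e. x i)"

lemma finite_monomials [simp]: "finite (monomials N)"
  unfolding monomials_def by (rule finite_multisets_bounded) simp

lemma mon_add: "mon (d + e) = mon d * mon e"
  by (simp add: mon_def)

lemma fps_mult_nth_less:
  fixes f g :: "'k fps"
  assumes "\<And>j. j < a \<Longrightarrow> f $ j = 0" "\<And>j. j < b \<Longrightarrow> g $ j = 0" "k < a + b"
  shows "(f * g) $ k = 0"
  unfolding fps_mult_nth
proof (intro sum.neutral ballI)
  fix j assume "j \<in> {0..k}"
  then show "f $ j * g $ (k - j) = 0"
    using assms by (cases "j < a") auto
qed

lemma mon_nth_less:
  assumes "set_mset e \<subseteq> {1..n}" "k < size e"
  shows "mon e $ k = 0"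
  using assms
proof (induction e arbitrary: k)
  case (add i e)
  have "(x i * mon e) $ k = 0"
    using add x_nth_0[of i] by (intro fps_mult_nth_less[of 1 _ "size e"]) auto
  then show ?case
    by (simp add: mon_def)
qed simp

text \<open>A monomial of size above \<open>k\<close> evaluates to a series of order above
  \<open>k\<close>, so the cutoff may be raised freely. This gives all coefficients up to
  \<open>N\<close> a common finite index set.\<close>

lemma ev_nth:
  assumes "k \<le> N"
  shows "ev F $ k = (\<Sum>e\<in>monomials N. F e * mon e $ k)"
proof -
  have "ev F $ k = (\<Sum>e\<in>monomials k. F e * mon e $ k)"
    by (simp add: mps_eval_def monomials_def mon_def)
  also have "\<dots> = (\<Sum>e\<in>monomials N. F e * mon e $ k)"
    using assms mon_nth_less
    by (intro sum.mono_neutral_left ballI) (auto simp: mem_monomials intro!: mult_eq_0_iff[THEN iffD2] disjI2)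
  finally show ?thesis .
qed

definition trunc :: "nat \<Rightarrow> 'k mps \<Rightarrow> 'k fps" where
  "trunc N F = (\<Sum>e\<in>monomials N. fps_const (F e) * mon e)"

lemma ev_nth_trunc: "k \<le> N \<Longrightarrow> ev F $ k = trunc N F $ k"
  by (simp add: ev_nth trunc_def fps_sum_nth)

lemma ev_add: "ev (\<lambda>e. F e + G e) = ev F + ev G"
  by (rule fps_ext) (simp add: mps_eval_def algebra_simps sum.distrib)

lemma ev_smult: "ev (\<lambda>e. c * F e) = fps_const c * ev F"
  by (rule fps_ext) (simp add: mps_eval_def algebra_simps sum_distrib_left)

lemma ev_diff: "ev (\<lambda>e. F e - G e) = ev F - ev G"
  by (rule fps_ext) (simp add: mps_eval_def algebra_simps sum_subtractf)

lemma ev_zero: "ev (\<lambda>e. 0) = 0"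
  by (rule fps_ext) (simp add: mps_eval_def)

lemma ev_sum: "finite A \<Longrightarrow> ev (\<lambda>e. \<Sum>j\<in>A. F j e) = (\<Sum>j\<in>A. ev (F j))"
  by (induction A rule: finite_induct) (simp_all add: ev_add ev_zero)

lemma ev_single:
  assumes "set_mset d \<subseteq> {1..n}"
  shows "ev (\<lambda>e. if e = d then c else 0) = fps_const c * mon d"
proof (rule fps_ext)
  fix k
  define N where "N = max k (size d)"
  have "ev (\<lambda>e. if e = d then c else 0) $ k = (\<Sum>e\<in>monomials N. (if e = d then c else 0) * mon e $ k)"
    by (rule ev_nth) (simp add: N_def)
  also have "\<dots> = (\<Sum>e\<in>{d}. c * mon e $ k)"
    using assms by (intro sum.mono_neutral_cong_right) (auto simp: mem_monomials N_def)
  finally show "ev (\<lambda>e. if e = d then c else 0) $ k = (fps_const c * mon d) $ k"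
    by simp
qed

lemma ev_const: "ev (\<lambda>e. if e = {#} then c else 0) = fps_const c"
  by (subst ev_single) (auto simp: mon_def)

lemma ev_var: "i \<in> {1..n} \<Longrightarrow> ev (mps_var i) = x i"
  unfolding mps_var_def by (subst ev_single) (auto simp: mon_def)

text \<open>For the coefficient at \<open>k\<close>, both factors may be truncated at
  \<open>k\<close>. Pairs of monomials of total size above \<open>k\<close> contribute nothing, and
  the others are regrouped by their sum.\<close>

lemma ev_mult: "ev (mps_mult F G) = ev F * ev G"
proof (rule fps_ext)
  fix k
  have "(ev F * ev G) $ k = (trunc k F * trunc k G) $ k"
    unfolding fps_mult_nth by (intro sum.cong) (simp_all add: ev_nth_trunc)
  also have "\<dots> = (\<Sum>(d, c)\<in>monomials k \<times> monomials k. F d * G c * mon (d + c) $ k)"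
    by (simp add: trunc_def sum_product fps_sum_nth sum.cartesian_product mon_add mult.assoc case_prod_unfold
        mult.left_commute[of "mon _"] flip: fps_const_mult)
  also have "\<dots> = (\<Sum>(d, c)\<in>{p \<in> monomials k \<times> monomials k. size (fst p) + size (snd p) \<le> k}.
      F d * G c * mon (d + c) $ k)"
  proof (rule sum.mono_neutral_right)
    have "mon (d + c) $ k = 0" if "d \<in> monomials k" "c \<in> monomials k" "k < size d + size c" for c d
      using that by (intro mon_nth_less) (simp_all add: mem_monomials)
    then show "\<forall>p\<in>monomials k \<times> monomials k -
        {p \<in> monomials k \<times> monomials k. size (fst p) + size (snd p) \<le> k}.
        (case p of (d, c) \<Rightarrow> F d * G c * mon (d + c) $ k) = 0"
      by clarsimp (meson not_le)
  qed auto
  also have "\<dots> = (\<Sum>(e, d)\<in>(SIGMA e:monomials k. {d. d \<subseteq># e}). F d * G (e - d) * mon e $ k)"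
  proof (rule sum.reindex_bij_witness[of _ "\<lambda>(e, d). (d, e - d)" "\<lambda>(d, c). (d + c, d)"], goal_cases)
    case (4 p)
    then obtain e d where p: "p = (e, d)" "d \<subseteq># e" "e \<in> monomials k"
      by auto
    then have "d \<in> monomials k" "e - d \<in> monomials k"
      using submultiset_monomials diff_subset_eq_self by blast+
    with p show ?case
      by (auto simp: mem_monomials size_Diff_submset size_mset_mono)
  qed (auto simp: mem_monomials)
  also have "\<dots> = ev (mps_mult F G) $ k"
    by (simp add: sum.Sigma ev_nth[OF order_refl] sum_distrib_right)
  finally show "ev (mps_mult F G) $ k = (ev F * ev G) $ k"
    by simp
qed

lemma fps_XD_mult: "fps_XD (f * g) = fps_XD f * g + f * fps_XD (g :: 'k fps)"
  by (simp add: fps_XD_def algebra_simps)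

lemma fps_XD_mon:
  assumes "set_mset e \<subseteq> {1..n}"
  shows "fps_XD (mon e) = (\<Sum>i\<in>{1..n}. of_nat (count e i) * (mon (e - {#i#}) * fps_XD (x i)))"
  using assms
proof (induction e)
  case empty
  then show ?case
    by (simp add: mon_def fps_XD_def)
next
  case (add i e)
  have i: "i \<in> {1..n}"
    using add.prems by simp
  have *: "of_nat (count (add_mset i e) j) * (mon (add_mset i e - {#j#}) * fps_XD (x j)) =
    x i * (of_nat (count e j) * (mon (e - {#j#}) * fps_XD (x j))) +
      (if j = i then mon e * fps_XD (x i) else 0)" for j
  proof (cases "j \<in># e")
    case True
    then have "mon (add_mset i e - {#j#}) = x i * mon (e - {#j#})"
      by (simp add: mon_def)
    moreover have "x i * mon (e - {#i#}) = mon e" if "i = j"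
      using True that by (metis mon_def image_mset_add_mset insert_DiffM prod_mset.add_mset)
    ultimately show ?thesis
      by (auto simp: algebra_simps)
  qed (auto simp: not_in_iff)
  have "fps_XD (mon (add_mset i e)) = x i * fps_XD (mon e) + mon e * fps_XD (x i)"
    by (simp add: mon_def fps_XD_mult algebra_simps)
  also have "\<dots> = (\<Sum>j\<in>{1..n}. x i * (of_nat (count e j) * (mon (e - {#j#}) * fps_XD (x j))) +
      (if j = i then mon e * fps_XD (x i) else 0))"
    using add i by (simp add: sum.distrib sum_distrib_left)
  finally show ?case
    unfolding * .
qed

text \<open>The chain rule. Differentiation lowers the size of a monomial by one, so the monomials
  of \<open>F\<close> up to size \<open>Suc k\<close> have to be kept for the coefficient at
  \<open>k\<close>.\<close>

lemma fps_XD_ev: "fps_XD (ev F) = (\<Sum>i\<in>{1..n}. ev (mps_pderiv i F) * fps_XD (x i))"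
proof (rule fps_ext)
  fix k
  define y where "y i d = (mon d * fps_XD (x i)) $ k" for i d
  have right: "(ev (mps_pderiv i F) * fps_XD (x i)) $ k =
      (\<Sum>e\<in>monomials (Suc k). F e * (of_nat (count e i) * y i (e - {#i#})))"
    if i: "i \<in> {1..n}" for i
  proof -
    have "(ev (mps_pderiv i F) * fps_XD (x i)) $ k = (trunc k (mps_pderiv i F) * fps_XD (x i)) $ k"
      unfolding fps_mult_nth by (intro sum.cong) (simp_all add: ev_nth_trunc)
    also have "\<dots> = (\<Sum>d\<in>monomials k. mps_pderiv i F d * y i d)"
      by (simp add: trunc_def sum_distrib_right fps_sum_nth mult.assoc y_def)
    also have "\<dots> = (\<Sum>e\<in>{e \<in> monomials (Suc k). i \<in># e}. F e * (of_nat (count e i) * y i (e - {#i#})))"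
      by (rule sum.reindex_bij_witness[of _ "\<lambda>e. e - {#i#}" "add_mset i"])
        (use i in \<open>auto simp: mem_monomials mps_pderiv_def size_Diff_singleton mult_ac dest: in_diffD\<close>)
    also have "\<dots> = (\<Sum>e\<in>monomials (Suc k). F e * (of_nat (count e i) * y i (e - {#i#})))"
      by (rule sum.mono_neutral_left) (auto simp: not_in_iff)
    finally show ?thesis .
  qed
  have "fps_XD (ev F) $ k = (\<Sum>e\<in>monomials (Suc k). F e * fps_XD (mon e) $ k)"
    by (simp add: ev_nth[of k "Suc k"] sum_distrib_left mult.left_commute)
  also have "\<dots> = (\<Sum>e\<in>monomials (Suc k). \<Sum>i\<in>{1..n}. F e * (of_nat (count e i) * y i (e - {#i#})))"
    by (intro sum.cong)
      (auto simp: mem_monomials fps_XD_mon fps_sum_nth sum_distrib_left y_def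
        fps_mult_of_nat_nth simp del: fps_XD_nth)
  also have "\<dots> = (\<Sum>i\<in>{1..n}. \<Sum>e\<in>monomials (Suc k). F e * (of_nat (count e i) * y i (e - {#i#})))"
    by (rule sum.swap)
  finally show "fps_XD (ev F) $ k = (\<Sum>i\<in>{1..n}. ev (mps_pderiv i F) * fps_XD (x i)) $ k"
    by (simp add: fps_sum_nth right)
qed

end

section \<open>Differentials of a parametrized curve\<close>

lemma mps_carrier_add: "F \<in> mps_carrier n \<Longrightarrow> G \<in> mps_carrier n \<Longrightarrow> (\<lambda>d. F d + G d) \<in> mps_carrier n"
  by clarsimp (metis add.right_neutral add_0 subsetD atLeastAtMost_iff One_nat_def)

lemma mps_carrier_smult: "F \<in> mps_carrier n \<Longrightarrow> (\<lambda>d. c d * F d) \<in> mps_carrier n"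
  by auto

lemma mps_carrier_diff: "F \<in> mps_carrier n \<Longrightarrow> G \<in> mps_carrier n \<Longrightarrow> (\<lambda>d. F d - G d) \<in> mps_carrier n"
  using mps_carrier_add[of F n "\<lambda>d. (-1) * G d"] mps_carrier_smult[of G n "\<lambda>_. -1"] by simp

lemma mps_carrier_single: "set_mset d \<subseteq> {1..n} \<Longrightarrow> (\<lambda>e. if e = d then c else 0) \<in> mps_carrier n"
  by auto

lemma mps_var_carrier: "i \<in> {1..n} \<Longrightarrow> mps_var i \<in> mps_carrier n"
  unfolding mps_var_def by (rule mps_carrier_single) simp

lemma mps_pderiv_add: "mps_pderiv i (\<lambda>d. F d + G d) = (\<lambda>d. mps_pderiv i F d + mps_pderiv i G d)"
  by (simp add: mps_pderiv_def algebra_simps)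

lemma mps_pderiv_diff: "mps_pderiv i (\<lambda>d. F d - G d) = (\<lambda>d. mps_pderiv i F d - mps_pderiv i G d)"
  by (simp add: mps_pderiv_def algebra_simps)

lemma mps_pderiv_var: "mps_pderiv i (mps_var j) = (\<lambda>d. if d = {#} then (if i = j then 1 else 0) else 0)"
  by (rule ext) (auto simp: mps_pderiv_def mps_var_def)

text \<open>Terms are sorted by their exponent modulo \<open>e\<close>. For x_1 = t^e this says that
  1, t, ..., t^(e-1) span k[[t]] over k[[x_1]].\<close>

lemma fps_residue_decomposition:
  fixes g :: "'k::field fps"
  assumes "0 < e"
  shows "g = (\<Sum>j<e. fps_X ^ j * Abs_fps (\<lambda>k. if e dvd k then g $ (k + j) else 0))"
proof (rule fps_ext)
  fix k
  have "(\<Sum>j<e. (fps_X ^ j * Abs_fps (\<lambda>k. if e dvd k then g $ (k + j) else 0)) $ k) =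
    (\<Sum>j<e. if j = k mod e then g $ k else 0)"
  proof (rule sum.cong)
    fix j assume "j \<in> {..<e}"
    then have "j \<le> k \<and> e dvd k - j \<longleftrightarrow> j = k mod e"
      using mod_eq_dvd_iff_nat[of j k e] assms mod_less_eq_dividend[of k e] by auto
    then show "(fps_X ^ j * Abs_fps (\<lambda>k. if e dvd k then g $ (k + j) else 0)) $ k =
        (if j = k mod e then g $ k else 0)"
      by (auto simp: fps_X_power_mult_nth)
  qed simp
  also have "\<dots> = g $ k"
    using assms by (simp add: sum.delta')
  finally show "g $ k = (\<Sum>j<e. fps_X ^ j * Abs_fps (\<lambda>k. if e dvd k then g $ (k + j) else 0)) $ k"
    by (simp add: fps_sum_nth)
qed

text \<open>\<open>gens\<close> and \<open>kernel\<close> say that the \<open>f j\<close> generate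
  the relations, \<open>order_two\<close> is the inclusion of the relations in the square of the
  ideal of the variables, and \<open>frac\<close> says that t is a quotient of elements of
  \<open>S\<close>.\<close>

locale mps_curve = mps_evaluation n x
  for n and x :: "nat \<Rightarrow> 'k::field_char_0 fps" +
  fixes S :: "'k fps set" and m e :: nat and f :: "nat \<Rightarrow> 'k mps"
  assumes n_pos: "1 \<le> n" and e_pos: "1 \<le> e" and x_1: "x 1 = fps_X ^ e"
    and image: "ev ` mps_carrier n = S"
    and gens: "\<And>j. j \<in> {1..m} \<Longrightarrow> f j \<in> mps_carrier n" "\<And>j. j \<in> {1..m} \<Longrightarrow> ev (f j) = 0"
    and kernel: "\<And>F. F \<in> mps_carrier n \<Longrightarrow> ev F = 0 \<Longrightarrow> F \<in> Idl\<^bsub>mps_ring n\<^esub> (f ` {1..m})"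
    and order_two: "\<And>F d. F \<in> mps_carrier n \<Longrightarrow> ev F = 0 \<Longrightarrow> size d < 2 \<Longrightarrow> F d = 0"
    and frac: "\<exists>q\<in>S. q \<noteq> 0 \<and> q * fps_X \<in> S"
begin

lemma lift: "s \<in> S \<Longrightarrow> \<exists>F\<in>mps_carrier n. ev F = s"
  using image by blast

lemma S_ev: "F \<in> mps_carrier n \<Longrightarrow> ev F \<in> S"
  using image by blast

lemma S_const: "fps_const c \<in> S"
  using S_ev[OF mps_carrier_single[of "{#}" n c]] by (simp add: ev_const)

lemma S_0: "0 \<in> S" and S_1: "1 \<in> S"
  using S_const[of 0] S_const[of 1] by auto

lemma S_add:
  assumes "s \<in> S" "t \<in> S"
  shows "s + t \<in> S"
proof -
  obtain F G where "F \<in> mps_carrier n" "ev F = s" "G \<in> mps_carrier n" "ev G = t"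
    using assms lift by blast
  then show ?thesis
    using S_ev[OF mps_carrier_add[of F n G]] by (simp add: ev_add)
qed

lemma S_diff:
  assumes "s \<in> S" "t \<in> S"
  shows "s - t \<in> S"
proof -
  obtain F G where "F \<in> mps_carrier n" "ev F = s" "G \<in> mps_carrier n" "ev G = t"
    using assms lift by blast
  then show ?thesis
    using S_ev[OF mps_carrier_diff[of F n G]] by (simp add: ev_diff)
qed

lemma S_mult:
  assumes "s \<in> S" "t \<in> S"
  shows "s * t \<in> S"
proof -
  obtain F G where "F \<in> mps_carrier n" "ev F = s" "G \<in> mps_carrier n" "ev G = t"
    using assms lift by blast
  then show ?thesis
    using S_ev[OF mps_mult_closed[of F n G]] by (simp add: ev_mult)
qed

lemma S_uminus: "s \<in> S \<Longrightarrow> - s \<in> S"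
  using S_diff[OF S_0] by simp

lemma S_power: "s \<in> S \<Longrightarrow> s ^ k \<in> S"
  by (induction k) (auto intro: S_1 S_mult)

lemma S_sum: "(\<And>j. j \<in> A \<Longrightarrow> g j \<in> S) \<Longrightarrow> sum g A \<in> S"
  by (induction A rule: infinite_finite_induct) (auto intro: S_0 S_add)

lemma S_of_nat: "of_nat k \<in> S"
  by (simp add: S_const fps_of_nat[symmetric])

lemma S_x: "i \<in> {1..n} \<Longrightarrow> x i \<in> S"
  using S_ev[OF mps_var_carrier, of i] ev_var[of i] by simp

lemma mon_pure: "set_mset d \<subseteq> {1} \<Longrightarrow> mon d = fps_X ^ (e * size d)"
proof (induction d)
  case (add i d)
  then show ?case
    using mon_add[of "{#1#}" d] by (simp add: mon_def x_1[simplified] power_add)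
qed (simp add: mon_def)

text \<open>A series in t^e is a series in x_1 and lifts to one in the single variable X_1. The
  vanishing partial derivatives make its differential a multiple of that of x_1.\<close>

lemma lift_pure:
  assumes "\<And>k. \<not> e dvd k \<Longrightarrow> g $ k = 0"
  shows "\<exists>F\<in>mps_carrier n. ev F = g \<and> (\<forall>i. i \<noteq> 1 \<longrightarrow> mps_pderiv i F = (\<lambda>_. 0))"
proof (intro bexI conjI allI impI)
  define F where "F = (\<lambda>d :: nat multiset. if set_mset d \<subseteq> {1} then g $ (e * size d) else 0)"
  show "F \<in> mps_carrier n"
    using n_pos by (auto simp: F_def split: if_splits)
  show "mps_pderiv i F = (\<lambda>_. 0)" if "i \<noteq> 1" for i
    using that by (auto simp: F_def mps_pderiv_def)
  show "ev F = g"
  proof (rule fps_ext)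
    fix k
    have "ev F $ k = (\<Sum>d\<in>{d \<in> monomials k. set_mset d \<subseteq> {1}}. g $ (e * size d) * mon d $ k)"
      unfolding ev_nth[OF order_refl] by (rule sum.mono_neutral_cong_right) (auto simp: F_def)
    also have "\<dots> = (\<Sum>d\<in>{d \<in> monomials k. set_mset d \<subseteq> {1}}. if e * size d = k then g $ k else 0)"
      by (rule sum.cong) (auto simp: mon_pure[simplified] fps_X_power_nth)
    also have "\<dots> = (\<Sum>j\<in>{..k}. if e * j = k then g $ k else 0)"
    proof (rule sum.reindex_bij_witness[of _ "\<lambda>j. replicate_mset j 1" size])
      fix d assume "d \<in> {d \<in> monomials k. set_mset d \<subseteq> {1}}"
      then show "replicate_mset (size d) 1 = d"
        by (auto intro!: multiset_eqI simp: set_mset_subset_singletonD)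
          (metis set_mset_subset_singletonD count_replicate_mset)+
    qed (use n_pos in \<open>auto simp: mem_monomials split: if_splits\<close>)
    also have "\<dots> = g $ k"
    proof (cases "e dvd k")
      case True
      then obtain j where j: "k = e * j"
        by blast
      have "e * j' = k \<longleftrightarrow> j' = j" for j'
        using j e_pos by auto
      moreover have "j \<le> k"
        using j e_pos by simp
      ultimately show ?thesis
        by simp
    next
      case False
      then show ?thesis
        using assms by (auto intro!: sum.neutral)
    qed
    finally show "ev F $ k = g $ k" .
  qed
qed

lemma S_pure: "(\<And>k. \<not> e dvd k \<Longrightarrow> g $ k = 0) \<Longrightarrow> g \<in> S"
  using lift_pure[of g] S_ev by blast

text \<open>If \<open>q\<close> is a denominator of t, then q^e clears t^j for all j < e, and by the
  decomposition into residue classes it clears every series. Any series of order at least that of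
  q^e is a multiple of q^e.\<close>

lemma conductor_exponent: "\<exists>N. \<forall>g. (\<forall>k<N. g $ k = 0) \<longrightarrow> g \<in> S"
proof -
  obtain q where q: "q \<in> S" "q \<noteq> 0" "q * fps_X \<in> S"
    using frac by blast
  have 1: "q ^ e * fps_X ^ j \<in> S" if "j < e" for j
  proof -
    have "q ^ e * fps_X ^ j = q ^ (e - j) * (q * fps_X) ^ j"
      using that by (simp add: power_mult_distrib mult.assoc[symmetric] flip: power_add)
    then show ?thesis
      using q by (simp add: S_mult S_power)
  qed
  have 2: "q ^ e * g \<in> S" for g
  proof -
    have "q ^ e * g = (\<Sum>j<e. (q ^ e * fps_X ^ j) * Abs_fps (\<lambda>k. if e dvd k then g $ (k + j) else 0))"
      using e_pos by (subst fps_residue_decomposition[of e g]) (auto simp: sum_distrib_left mult.assoc)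
    also have "\<dots> \<in> S"
      by (intro S_sum S_mult 1 S_pure) auto
    finally show ?thesis .
  qed
  have "g \<in> S" if "\<forall>k<subdegree (q ^ e). g $ k = 0" for g
  proof (cases "g = 0")
    case False
    then have "subdegree (q ^ e) \<le> subdegree g"
      using that by (intro subdegree_geI) auto
    then have "q ^ e dvd g"
      using q(2) False by (subst fps_dvd_iff) auto
    then show ?thesis
      using 2 by (auto elim: dvdE)
  qed (simp add: S_0)
  then show ?thesis
    by blast
qed

section \<open>Gradients and the relations among the differentials\<close>

definition grad :: "'k mps \<Rightarrow> nat \<Rightarrow> 'k fps" where
  "grad F i = ev (mps_pderiv i F)"

text \<open>The submodule by which S^n is divided to obtain the differentials. Taking gradients of
  all relations avoids the generators; \<open>jacobian_image\<close> identifies the result with the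
  image of the Jacobian matrix. Only the entries at \<open>{1..n}\<close> matter, since vectors are
  total functions here.\<close>

definition rels :: "(nat \<Rightarrow> 'k fps) set" where
  "rels = {v. \<exists>F\<in>mps_carrier n. ev F = 0 \<and> (\<forall>i\<in>{1..n}. v i = grad F i)}"

lemma grad_mult: "grad (mps_mult F G) i = ev F * grad G i + ev G * grad F i"
  unfolding grad_def mps_pderiv_mult ev_add by (simp add: ev_mult algebra_simps)

lemma grad_add: "grad (\<lambda>d. F d + G d) i = grad F i + grad G i"
  by (simp add: grad_def mps_pderiv_add ev_add)

lemma grad_diff: "grad (\<lambda>d. F d - G d) i = grad F i - grad G i"
  by (simp add: grad_def mps_pderiv_diff ev_diff)

lemma grad_var: "grad (mps_var j) i = (if i = j then 1 else 0)"
  by (simp add: grad_def mps_pderiv_var ev_const)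

lemma grad_closed: "F \<in> mps_carrier n \<Longrightarrow> grad F i \<in> S"
  unfolding grad_def by (intro S_ev mps_pderiv_closed)

lemma grad_rels: "F \<in> mps_carrier n \<Longrightarrow> ev F = 0 \<Longrightarrow> grad F \<in> rels"
  by (auto simp: rels_def)

lemma rels_cong: "(\<And>i. i \<in> {1..n} \<Longrightarrow> v i = w i) \<Longrightarrow> v \<in> rels \<Longrightarrow> w \<in> rels"
  unfolding rels_def by auto

lemma rels_zero: "(\<lambda>_. 0) \<in> rels"
  unfolding rels_def by (auto simp: grad_def mps_pderiv_def ev_zero intro!: bexI[of _ "\<lambda>_. 0"])

lemma rels_add:
  assumes "v \<in> rels" "w \<in> rels"
  shows "(\<lambda>i. v i + w i) \<in> rels"
proof -
  obtain F G where "F \<in> mps_carrier n" "ev F = 0" "\<forall>i\<in>{1..n}. v i = grad F i"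
    "G \<in> mps_carrier n" "ev G = 0" "\<forall>i\<in>{1..n}. w i = grad G i"
    using assms unfolding rels_def by blast
  then show ?thesis
    unfolding rels_def using mps_carrier_add[of F n G]
    by (intro CollectI bexI[of _ "\<lambda>d. F d + G d"]) (auto simp: ev_add grad_add)
qed

lemma rels_smult:
  assumes "v \<in> rels" "s \<in> S"
  shows "(\<lambda>i. s * v i) \<in> rels"
proof -
  obtain F G where "F \<in> mps_carrier n" "ev F = 0" "\<forall>i\<in>{1..n}. v i = grad F i"
    "G \<in> mps_carrier n" "ev G = s"
    using assms lift unfolding rels_def by blast
  then show ?thesis
    unfolding rels_def using mps_mult_closed[of G n F]
    by (intro CollectI bexI[of _ "mps_mult G F"]) (auto simp: ev_mult grad_mult)
qed

lemma XD_ev: "fps_XD (ev F) = (\<Sum>i\<in>{1..n}. grad F i * fps_XD (x i))"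
  by (simp add: fps_XD_ev grad_def)

lemma rels_syzygy:
  assumes "v \<in> rels"
  shows "(\<Sum>i\<in>{1..n}. v i * fps_XD (x i)) = 0"
proof -
  obtain F where F: "ev F = 0" "\<And>i. i \<in> {1..n} \<Longrightarrow> v i = grad F i"
    using assms unfolding rels_def by blast
  have "(\<Sum>i\<in>{1..n}. v i * fps_XD (x i)) = fps_XD (ev F)"
    unfolding XD_ev by (rule sum.cong) (simp_all add: F(2))
  then show ?thesis
    by (simp add: F(1) fps_XD_def)
qed

lemma XD_x_1: "fps_XD (x 1) = of_nat e * fps_X ^ e"
  unfolding x_1 using e_pos
  by (intro fps_ext) (simp add: fps_X_power_nth fps_mult_of_nat_nth)

section \<open>Every syzygy of the differentials is torsion\<close>

text \<open>The vectors which become proportional to the first unit vector in the fibre of the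
  module of differentials over the fraction field.\<close>

definition generic :: "(nat \<Rightarrow> 'k fps) set" where
  "generic = {v. \<exists>r\<in>S. r \<noteq> 0 \<and> (\<exists>s\<in>S. (\<lambda>i. r * v i - (if i = 1 then s else 0)) \<in> rels)}"

lemma generic_rels:
  assumes "v \<in> rels"
  shows "v \<in> generic"
  unfolding generic_def
  by (intro CollectI bexI[of _ 1] conjI bexI[of _ 0]) (simp_all add: assms S_0 S_1)

lemma generic_cong:
  assumes "\<And>i. i \<in> {1..n} \<Longrightarrow> v i = w i" "v \<in> generic"
  shows "w \<in> generic"
proof -
  obtain r s where "r \<in> S" "r \<noteq> 0" "s \<in> S" "(\<lambda>i. r * v i - (if i = 1 then s else 0)) \<in> rels"
    using assms(2) unfolding generic_def by blast
  moreover from this(4) have "(\<lambda>i. r * w i - (if i = 1 then s else 0)) \<in> rels"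
    by (rule rels_cong[rotated]) (simp add: assms(1))
  ultimately show ?thesis
    unfolding generic_def by blast
qed

lemma generic_pure:
  assumes "v 1 \<in> S" "\<And>i. i \<noteq> 1 \<Longrightarrow> v i = 0"
  shows "v \<in> generic"
proof -
  have "(\<lambda>i. 1 * v i - (if i = 1 then v 1 else 0)) = (\<lambda>_. 0)"
    using assms by auto
  then show ?thesis
    unfolding generic_def using assms S_1 rels_zero
    by (intro CollectI bexI[of _ 1] conjI bexI[of _ "v 1"]) simp_all
qed

lemma generic_add:
  assumes "v \<in> generic" "w \<in> generic"
  shows "(\<lambda>i. v i + w i) \<in> generic"
proof -
  obtain r s r' s' where rs: "r \<in> S" "r \<noteq> 0" "s \<in> S" "r' \<in> S" "r' \<noteq> 0" "s' \<in> S"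
    and v: "(\<lambda>i. r * v i - (if i = 1 then s else 0)) \<in> rels"
    and w: "(\<lambda>i. r' * w i - (if i = 1 then s' else 0)) \<in> rels"
    using assms unfolding generic_def by blast
  have "(\<lambda>i. r' * (r * v i - (if i = 1 then s else 0)) + r * (r' * w i - (if i = 1 then s' else 0))) \<in> rels"
    using rs by (intro rels_add rels_smult v w)
  also have "(\<lambda>i. r' * (r * v i - (if i = 1 then s else 0)) + r * (r' * w i - (if i = 1 then s' else 0))) =
    (\<lambda>i. (r * r') * (v i + w i) - (if i = 1 then r' * s + r * s' else 0))"
    by (auto simp: algebra_simps)
  finally show ?thesis
    unfolding generic_def using rs
    by (intro CollectI bexI[of _ "r * r'"] conjI bexI[of _ "r' * s + r * s'"]) (auto intro: S_add S_mult)
qed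

lemma generic_smult:
  assumes "v \<in> generic" "t \<in> S"
  shows "(\<lambda>i. t * v i) \<in> generic"
proof -
  obtain r s where rs: "r \<in> S" "r \<noteq> 0" "s \<in> S"
    and v: "(\<lambda>i. r * v i - (if i = 1 then s else 0)) \<in> rels"
    using assms unfolding generic_def by blast
  have "(\<lambda>i. t * (r * v i - (if i = 1 then s else 0))) \<in> rels"
    using assms by (intro rels_smult v)
  also have "(\<lambda>i. t * (r * v i - (if i = 1 then s else 0))) =
    (\<lambda>i. r * (t * v i) - (if i = 1 then t * s else 0))"
    by (auto simp: algebra_simps)
  finally show ?thesis
    unfolding generic_def using rs assms
    by (intro CollectI bexI[of _ r] conjI bexI[of _ "t * s"]) (auto intro: S_mult)
qed

lemma generic_cancel:
  assumes "(\<lambda>i. t * v i) \<in> generic" "t \<in> S" "t \<noteq> 0"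
  shows "v \<in> generic"
proof -
  obtain r s where rs: "r \<in> S" "r \<noteq> 0" "s \<in> S"
    and v: "(\<lambda>i. r * (t * v i) - (if i = 1 then s else 0)) \<in> rels"
    using assms unfolding generic_def by blast
  then show ?thesis
    unfolding generic_def using assms
    by (intro CollectI bexI[of _ "r * t"] conjI bexI[of _ s]) (auto intro: S_mult simp: mult.assoc)
qed

lemma generic_sum: "(\<And>j. j \<in> A \<Longrightarrow> v j \<in> generic) \<Longrightarrow> (\<lambda>i. \<Sum>j\<in>A. v j i) \<in> generic"
  by (induction A rule: infinite_finite_induct) (auto intro: generic_add generic_rels rels_zero)

text \<open>Over the fraction field, the differential of \<open>h\<close> is a multiple of that of
  x_1. Asking this of all lifts is no stronger than asking it of one, because two lifts differ by a
  relation.\<close>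

definition tame :: "'k fps \<Rightarrow> bool" where
  "tame h \<longleftrightarrow> h \<in> S \<and> (\<forall>F\<in>mps_carrier n. ev F = h \<longrightarrow> grad F \<in> generic)"

lemma tameI:
  assumes F: "F \<in> mps_carrier n" "ev F = h" "grad F \<in> generic"
  shows "tame h"
  unfolding tame_def
proof (intro conjI ballI impI)
  show "h \<in> S"
    using F S_ev by blast
  fix G assume G: "G \<in> mps_carrier n" "ev G = h"
  have "grad (\<lambda>d. G d - F d) \<in> rels"
    using F G by (intro grad_rels mps_carrier_diff) (auto simp: ev_diff)
  then have "(\<lambda>i. grad F i + grad (\<lambda>d. G d - F d) i) \<in> generic"
    by (intro generic_add F generic_rels)
  then show "grad G \<in> generic"
    by (rule generic_cong[rotated]) (simp add: grad_diff)
qed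

lemma tameE:
  assumes "tame h"
  obtains F where "F \<in> mps_carrier n" "ev F = h" "grad F \<in> generic"
  using assms lift unfolding tame_def by blast

lemma tame_pure:
  assumes "\<And>k. \<not> e dvd k \<Longrightarrow> g $ k = 0"
  shows "tame g"
proof -
  obtain F where F: "F \<in> mps_carrier n" "ev F = g" "\<And>i. i \<noteq> 1 \<Longrightarrow> mps_pderiv i F = (\<lambda>_. 0)"
    using lift_pure[of g] assms by blast
  have "grad F \<in> generic"
    by (rule generic_pure) (use F grad_closed[OF F(1)] in \<open>simp_all add: grad_def ev_zero\<close>)
  then show ?thesis
    using F tameI by blast
qed

lemma tame_add:
  assumes "tame g" "tame h"
  shows "tame (g + h)"
proof -
  obtain F where F: "F \<in> mps_carrier n" "ev F = g" "grad F \<in> generic"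
    using assms tameE by blast
  obtain G where G: "G \<in> mps_carrier n" "ev G = h" "grad G \<in> generic"
    using assms tameE by blast
  show ?thesis
    using generic_add[OF F(3) G(3)]
    by (intro tameI[OF mps_carrier_add[OF F(1) G(1)]]) (simp_all add: ev_add grad_add[abs_def] F G)
qed

lemma tame_mult:
  assumes "tame g" "tame h"
  shows "tame (g * h)"
proof -
  obtain F where F: "F \<in> mps_carrier n" "ev F = g" "grad F \<in> generic"
    using assms tameE by blast
  obtain G where G: "G \<in> mps_carrier n" "ev G = h" "grad G \<in> generic"
    using assms tameE by blast
  have "(\<lambda>i. ev F * grad G i + ev G * grad F i) \<in> generic"
    using F G by (intro generic_add generic_smult S_ev)
  then show ?thesis
    using F G by (intro tameI[of "mps_mult F G"] mps_mult_closed) (auto simp: ev_mult grad_mult[abs_def])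
qed

lemma tame_sum: "(\<And>j. j \<in> A \<Longrightarrow> tame (g j)) \<Longrightarrow> tame (sum g A)"
  by (induction A rule: infinite_finite_induct) (auto intro: tame_add tame_pure)

text \<open>The product rule is solved for the differential of \<open>h\<close>: g dh = d(gh) - h
  dg, and \<open>g\<close> is invertible in the fraction field.\<close>

lemma tame_cancel:
  assumes "tame (g * h)" "tame g" "g \<noteq> 0" "h \<in> S"
  shows "tame h"
proof -
  obtain F where F: "F \<in> mps_carrier n" "ev F = g" "grad F \<in> generic"
    using assms tameE by blast
  obtain G where G: "G \<in> mps_carrier n" "ev G = h"
    using assms lift by blast
  have "grad (mps_mult F G) \<in> generic"
    using assms(1) mps_mult_closed[OF F(1) G(1)] ev_mult[of F G] F(2) G(2)
    unfolding tame_def by blast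
  then have "(\<lambda>i. grad (mps_mult F G) i + (- h) * grad F i) \<in> generic"
    using F assms by (intro generic_add generic_smult S_uminus)
  then have "(\<lambda>i. g * grad G i) \<in> generic"
    using F G by (simp add: grad_mult)
  then show ?thesis
    using F G assms S_ev by (intro tameI[of G]) (auto intro: generic_cancel)
qed

lemma grad_power:
  assumes "F \<in> mps_carrier n"
  shows "\<exists>G\<in>mps_carrier n. ev G = ev F ^ Suc k \<and> (\<forall>i. grad G i = of_nat (Suc k) * ev F ^ k * grad F i)"
proof (induction k)
  case 0
  then show ?case
    using assms by auto
next
  case (Suc k)
  then obtain G where "G \<in> mps_carrier n" "ev G = ev F ^ Suc k"
    "\<forall>i. grad G i = of_nat (Suc k) * ev F ^ k * grad F i"
    by blast
  then show ?case
    using assms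
    by (intro bexI[of _ "mps_mult F G"] mps_mult_closed) (auto simp: ev_mult grad_mult algebra_simps)
qed

text \<open>The differential of h^k is k h^(k-1) dh, and the factor k h^(k-1) is nonzero in
  characteristic 0.\<close>

lemma tame_root:
  assumes "tame (h ^ k)" "h \<in> S" "h \<noteq> 0" "1 \<le> k"
  shows "tame h"
proof -
  obtain F where F: "F \<in> mps_carrier n" "ev F = h"
    using assms lift by blast
  obtain G where G: "G \<in> mps_carrier n" "ev G = h ^ k"
      "\<And>i. grad G i = of_nat k * h ^ (k - 1) * grad F i"
    using grad_power[OF F(1), of "k - 1"] assms(4) F(2) by auto
  have "grad G \<in> generic"
    using assms(1) G unfolding tame_def by blast
  also have "grad G = (\<lambda>i. (of_nat k * h ^ (k - 1)) * grad F i)"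
    using G by auto
  finally have "grad F \<in> generic"
    by (rule generic_cancel) (use assms in \<open>auto intro: S_mult S_power S_of_nat\<close>)
  then show ?thesis
    using F tameI by blast
qed

text \<open>The large powers of the uniformizer are roots of powers of \<open>x\<^sub>1\<close>, and together with
  series in \<open>x\<^sub>1\<close> they generate a multiple of every series.\<close>

lemma tame_x:
  assumes "i \<in> {1..n}"
  shows "tame (x i)"
proof -
  obtain N where N: "\<And>g. (\<forall>k<N. g $ k = 0) \<Longrightarrow> g \<in> S"
    using conductor_exponent by blast
  have X: "tame (fps_X ^ (N + j))" for j
  proof (rule tame_root)
    show "tame ((fps_X ^ (N + j)) ^ e)"
      unfolding power_mult[symmetric] by (rule tame_pure) (auto simp: fps_X_power_nth)
  qed (use e_pos in \<open>auto intro!: N simp: fps_X_power_nth\<close>)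
  \<comment> \<open>Small powers of t need not lie in \<open>S\<close>. The factor t^N moves all
    those in the decomposition past the conductor and is cancelled afterwards.\<close>
  have "fps_X ^ N * x i =
      (\<Sum>j<e. fps_X ^ (N + j) * Abs_fps (\<lambda>k. if e dvd k then x i $ (k + j) else 0))"
    using e_pos by (subst fps_residue_decomposition[of e "x i"])
      (auto simp: sum_distrib_left power_add mult.assoc)
  also have "tame \<dots>"
    by (intro tame_sum tame_mult X tame_pure) auto
  finally show ?thesis
    by (rule tame_cancel) (use X[of 0] S_x[OF assms] in simp_all)
qed

text \<open>All \<open>x i\<close> being tame, some nonzero multiple of any vector over
  \<open>S\<close> is, modulo \<open>rels\<close>, \<open>s\<close> times the first unit vector. For
  a syzygy this gives s \<delta>x_1 = 0, and \<delta>x_1 = e t^e is nonzero, so \<open>s\<close>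
  vanishes.\<close>

lemma syzygy_torsion:
  assumes v: "\<And>i. i \<in> {1..n} \<Longrightarrow> v i \<in> S" "(\<Sum>i\<in>{1..n}. v i * fps_XD (x i)) = 0"
  shows "\<exists>r\<in>S. r \<noteq> 0 \<and> (\<lambda>i. r * v i) \<in> rels"
proof -
  have "(\<lambda>i. \<Sum>j\<in>{1..n}. v j * grad (mps_var j) i) \<in> generic"
    using tame_x ev_var mps_var_carrier unfolding tame_def
    by (intro generic_sum generic_smult v) blast+
  then have "v \<in> generic"
    by (rule generic_cong[rotated]) (simp add: grad_var sum.delta' if_distrib cong: if_cong)
  then obtain r s where r: "r \<in> S" "r \<noteq> 0"
    and s: "(\<lambda>i. r * v i - (if i = 1 then s else 0)) \<in> rels"
    unfolding generic_def by blast
  have "0 = (\<Sum>i\<in>{1..n}. (r * v i - (if i = 1 then s else 0)) * fps_XD (x i))"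
    using rels_syzygy[OF s] by simp
  also have "\<dots> = (\<Sum>i\<in>{1..n}. r * (v i * fps_XD (x i)) - (if i = 1 then s * fps_XD (x 1) else 0))"
    by (rule sum.cong) (auto simp: algebra_simps)
  also have "\<dots> = - (s * fps_XD (x 1))"
    using v(2) n_pos by (simp add: sum_subtractf flip: sum_distrib_left)
  finally have "s = 0"
    using e_pos by (simp add: XD_x_1[simplified])
  with s r show ?thesis
    by auto
qed

end

section \<open>The Jacobian presentation and its torsion\<close>

lemma mps_carrier_sum:
  assumes "\<And>j. j \<in> A \<Longrightarrow> F j \<in> mps_carrier n"
  shows "(\<lambda>d. \<Sum>j\<in>A. F j d) \<in> mps_carrier n"
  using assms
proof (induction A rule: infinite_finite_induct)
  case (insert a A)
  have "(\<lambda>d. F a d + (\<Sum>j\<in>A. F j d)) \<in> mps_carrier n"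
    using insert by (intro mps_carrier_add) auto
  then show ?case
    using insert.hyps by simp
qed auto

context mps_curve
begin

lemma rels_sum: "(\<And>j. j \<in> A \<Longrightarrow> v j \<in> rels) \<Longrightarrow> (\<lambda>i. \<Sum>j\<in>A. v j i) \<in> rels"
  by (induction A rule: infinite_finite_induct) (auto intro: rels_add rels_zero)

lemma jacobian_rels:
  assumes "\<And>j. j \<in> {1..m} \<Longrightarrow> c j \<in> S"
  shows "(\<lambda>i. \<Sum>j\<in>{1..m}. grad (f j) i * c j) \<in> rels"
proof -
  have "(\<lambda>i. \<Sum>j\<in>{1..m}. c j * grad (f j) i) \<in> rels"
    by (intro rels_sum rels_smult grad_rels assms gens)
  then show ?thesis
    by (simp add: mult.commute)
qed

text \<open>The relations whose gradient is a combination of the gradients of the \<open>f j\<close>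
  form an ideal \<open>K\<close> containing the \<open>f j\<close>, hence are all relations. The
  condition \<open>ev F = 0\<close> inside \<open>K\<close> removes the second term of the product
  rule and makes \<open>K\<close> an ideal.\<close>

lemma rels_jacobian:
  assumes "v \<in> rels"
  shows "\<exists>c. (\<forall>j. c j \<in> S) \<and> (\<forall>i\<in>{1..n}. v i = (\<Sum>j\<in>{1..m}. grad (f j) i * c j))"
proof -
  interpret R: cring "mps_ring n :: 'k mps ring"
    by (rule cring_mps_ring)
  have carrier: "carrier (mps_ring n) = mps_carrier n"
    by (simp add: mps_ring_def)
  define K where "K = {F \<in> mps_carrier n. ev F = 0 \<and>
    (\<exists>c. (\<forall>j. c j \<in> S) \<and> (\<forall>i. grad F i = (\<Sum>j\<in>{1..m}. grad (f j) i * c j)))}"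
  have "ideal K (mps_ring n)"
  proof (rule R.idealI')
    show "K \<subseteq> carrier (mps_ring n)"
      by (auto simp: K_def carrier)
    have "grad (\<lambda>_. 0) i = (\<Sum>j\<in>{1..m}. grad (f j) i * 0)" for i
      by (simp add: grad_def mps_pderiv_def ev_zero)
    then show "\<zero>\<^bsub>mps_ring n\<^esub> \<in> K"
      unfolding K_def by (auto simp: mps_ring_def ev_zero S_0 intro!: exI[of _ "\<lambda>_. 0"])
  next
    fix F G assume "F \<in> K" "G \<in> K"
    then obtain b c where FG: "F \<in> mps_carrier n" "ev F = 0" "G \<in> mps_carrier n" "ev G = 0"
      and bc: "\<forall>j. b j \<in> S" "\<forall>j. c j \<in> S"
      "\<forall>i. grad F i = (\<Sum>j\<in>{1..m}. grad (f j) i * b j)"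
      "\<forall>i. grad G i = (\<Sum>j\<in>{1..m}. grad (f j) i * c j)"
      unfolding K_def by blast
    have "\<forall>i. grad (\<lambda>d. F d + G d) i = (\<Sum>j\<in>{1..m}. grad (f j) i * (b j + c j))"
      using bc by (simp add: grad_add distrib_left sum.distrib)
    moreover have "(\<lambda>d. F d + G d) \<in> mps_carrier n" "ev (\<lambda>d. F d + G d) = 0"
      using mps_carrier_add[OF FG(1,3)] FG by (simp_all add: ev_add)
    moreover have "\<forall>j. b j + c j \<in> S"
      using bc S_add by blast
    ultimately have "(\<lambda>d. F d + G d) \<in> K"
      unfolding K_def mem_Collect_eq
      by (intro conjI exI[of _ "\<lambda>j. b j + c j"])
    then show "F \<oplus>\<^bsub>mps_ring n\<^esub> G \<in> K"
      by (simp add: mps_ring_def)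
  next
    fix F G :: "'k mps" assume "F \<in> K" and G: "G \<in> carrier (mps_ring n)"
    then obtain b where F: "F \<in> mps_carrier n" "ev F = 0"
      and b: "\<forall>j. b j \<in> S" "\<forall>i. grad F i = (\<Sum>j\<in>{1..m}. grad (f j) i * b j)"
      unfolding K_def by blast
    have "\<forall>i. grad (mps_mult G F) i = (\<Sum>j\<in>{1..m}. grad (f j) i * (ev G * b j))"
      using F b by (simp add: grad_mult sum_distrib_left mult.left_commute)
    moreover have "mps_mult G F \<in> mps_carrier n" "ev (mps_mult G F) = 0"
      using mps_mult_closed[of G n F] F G by (simp_all add: ev_mult carrier)
    moreover have "\<forall>j. ev G * b j \<in> S"
      using b G S_mult S_ev by (simp add: carrier)
    ultimately have "mps_mult G F \<in> K"
      unfolding K_def mem_Collect_eq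
      by (intro conjI exI[of _ "\<lambda>j. ev G * b j"])
    then show "G \<otimes>\<^bsub>mps_ring n\<^esub> F \<in> K"
      by (simp add: mps_ring_def)
  qed
  moreover have "f ` {1..m} \<subseteq> K"
  proof
    fix F assume "F \<in> f ` {1..m}"
    then obtain l where l: "l \<in> {1..m}" "F = f l"
      by blast
    have "grad F i = (\<Sum>j\<in>{1..m}. grad (f j) i * (if j = l then 1 else 0))" for i
    proof -
      have "(\<Sum>j\<in>{1..m}. grad (f j) i * (if j = l then 1 else 0)) =
          (\<Sum>j\<in>{1..m}. if j = l then grad (f l) i else 0)"
        by (rule sum.cong) auto
      then show ?thesis
        using l by simp
    qed
    then show "F \<in> K"
      unfolding K_def mem_Collect_eq using gens[OF l(1)] l(2) S_0 S_1
      by (intro conjI exI[of _ "\<lambda>j. if j = l then 1 else 0"]) auto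
  qed
  ultimately have "Idl\<^bsub>mps_ring n\<^esub> (f ` {1..m}) \<subseteq> K"
    by (rule R.genideal_minimal)
  moreover obtain F where F: "F \<in> mps_carrier n" "ev F = 0" "\<forall>i\<in>{1..n}. v i = grad F i"
    using assms unfolding rels_def by blast
  ultimately have "F \<in> K"
    using kernel[OF F(1,2)] by blast
  then show ?thesis
    using F(3) unfolding K_def by auto
qed

lemma jacobian_image:
  "jacobian_map n x m f ` carrier (free_module (fps_ring S) m) = {u \<in> extensional {1..n}. u \<in> rels}"
proof (intro subset_antisym subsetI)
  fix u assume "u \<in> jacobian_map n x m f ` carrier (free_module (fps_ring S) m)"
  then obtain c where c: "c \<in> {1..m} \<rightarrow>\<^sub>E S" and u: "u = jacobian_map n x m f c"
    by (auto simp: free_module_def fps_ring_def)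
  have "c j \<in> S" if "j \<in> {1..m}" for j
    using c that by (rule PiE_mem)
  with jacobian_rels have "(\<lambda>i. \<Sum>j\<in>{1..m}. grad (f j) i * c j) \<in> rels"
    by blast
  then have "u \<in> rels"
    by (rule rels_cong[rotated]) (simp add: u jacobian_map_def grad_def)
  then show "u \<in> {u \<in> extensional {1..n}. u \<in> rels}"
    by (simp add: u jacobian_map_def)
next
  fix u assume u: "u \<in> {u \<in> extensional {1..n}. u \<in> rels}"
  then obtain c where c: "\<forall>j. c j \<in> S" "\<forall>i\<in>{1..n}. u i = (\<Sum>j\<in>{1..m}. grad (f j) i * c j)"
    using rels_jacobian by blast
  show "u \<in> jacobian_map n x m f ` carrier (free_module (fps_ring S) m)"
  proof
    show "u = jacobian_map n x m f (\<lambda>j\<in>{1..m}. c j)"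
      using u c(2) by (intro extensionalityI[of _ "{1..n}"]) (auto simp: jacobian_map_def grad_def)
    show "(\<lambda>j\<in>{1..m}. c j) \<in> carrier (free_module (fps_ring S) m)"
      using c(1) by (auto simp: free_module_def fps_ring_def)
  qed
qed

text \<open>Absence of torsion means that \<open>rels\<close> is saturated: the class of
  \<open>v\<close> is annihilated by \<open>r\<close>, hence is zero.\<close>

lemma torsion_free_rels:
  assumes torsion: "torsion (fps_ring S) (differentials S n x m f) = {\<zero>\<^bsub>differentials S n x m f\<^esub>}"
    and v: "\<And>i. i \<in> {1..n} \<Longrightarrow> v i \<in> S" and r: "r \<in> S" "r \<noteq> 0" "(\<lambda>i. r * v i) \<in> rels"
  shows "v \<in> rels"
proof -
  define N where "N = {u \<in> extensional {1..n}. u \<in> rels}"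
  define M where "M = free_module (fps_ring S) n"
  define w where "w = (\<lambda>i\<in>{1..n}. v i)"
  have coset: "N +>\<^bsub>M\<^esub> u = (\<lambda>h. \<lambda>i\<in>{1..n}. h i + u i) ` N" for u
    by (auto simp: a_r_coset_def r_coset_def M_def free_module_def fps_ring_def)
  have N_add: "(\<lambda>i\<in>{1..n}. h i + u i) \<in> N" if "h \<in> N" "u \<in> rels" for h u
    using that rels_cong[OF _ rels_add[of h u], of "\<lambda>i\<in>{1..n}. h i + u i"] by (auto simp: N_def)
  have N_coset: "N +>\<^bsub>M\<^esub> u = N" if "u \<in> rels" for u
  proof
    show "N +>\<^bsub>M\<^esub> u \<subseteq> N"
      using N_add[OF _ that] unfolding coset by blast
    show "N \<subseteq> N +>\<^bsub>M\<^esub> u"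
    proof
      fix h assume h: "h \<in> N"
      have "(\<lambda>i. (-1) * u i) \<in> rels"
        by (rule rels_smult[OF that]) (use S_uminus[OF S_1] in simp)
      from N_add[OF h this] have "(\<lambda>i\<in>{1..n}. h i + (-1) * u i) \<in> N" .
      moreover have "h = (\<lambda>i\<in>{1..n}. (\<lambda>i\<in>{1..n}. h i + (-1) * u i) i + u i)"
        using h by (auto simp: N_def extensional_def)
      ultimately show "h \<in> N +>\<^bsub>M\<^esub> u"
        unfolding coset by blast
    qed
  qed
  have zero: "(\<lambda>i\<in>{1..n}. 0) \<in> N"
    using rels_cong[OF _ rels_zero, of "\<lambda>i\<in>{1..n}. 0"] by (auto simp: N_def)
  then have w_coset: "w \<in> N +>\<^bsub>M\<^esub> w"
    unfolding coset by (intro image_eqI[OF _ zero]) (auto simp: w_def)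
  \<comment> \<open>Scalar multiplication of a coset is a union over its representatives, so each
    representative is examined; \<open>w_coset\<close> provides one, which makes the union
    nonempty.\<close>
  have smult: "N +>\<^bsub>M\<^esub> (r \<odot>\<^bsub>M\<^esub> u) = N" if u: "u \<in> N +>\<^bsub>M\<^esub> w" for u
  proof -
    obtain h where h: "u = (\<lambda>i\<in>{1..n}. h i + w i)" "h \<in> N"
      using u unfolding coset by (rule imageE)
    have "(\<lambda>i. r * h i + r * v i) \<in> rels"
      using h r by (intro rels_add rels_smult[where v = h]) (auto simp: N_def)
    then have "r \<odot>\<^bsub>M\<^esub> u \<in> rels"
      by (rule rels_cong[rotated]) (simp add: M_def free_module_def fps_ring_def h w_def distrib_left)
    then show ?thesis
      by (rule N_coset)
  qed
  have diff: "differentials S n x m f = quotient_module M N"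
    by (simp add: differentials_def jacobian_image M_def N_def)
  have "w \<in> carrier M"
    using v by (auto simp: w_def M_def free_module_def fps_ring_def)
  then have "N +>\<^bsub>M\<^esub> w \<in> torsion (fps_ring S) (quotient_module M N)"
    unfolding torsion_def using r(1,2) smult w_coset
    by (auto simp: quotient_module_def A_RCOSETS_def RCOSETS_def a_r_coset_def fps_ring_def
        intro!: bexI[of _ r])
  then have "N +>\<^bsub>M\<^esub> w = N"
    using torsion unfolding diff by (simp add: quotient_module_def)
  then have "w \<in> rels"
    using w_coset by (simp add: N_def)
  then show ?thesis
    by (rule rels_cong[rotated]) (simp add: w_def)
qed

text \<open>A series of order at least \<open>j + 1\<close> is split according to the smallest variable occurring
  in each monomial.\<close>

lemma ev_ideal_pow:
  assumes I: "x ` {1..n} \<subseteq> I"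
    and F: "F \<in> mps_carrier n" "\<And>d. size d < j \<Longrightarrow> F d = 0"
  shows "ev F \<in> ideal_pow (fps_ring S) I j"
  using F
proof (induction j arbitrary: F)
  case 0
  then show ?case
    using S_ev by (simp add: ideals_set_def fps_ring_def)
next
  case (Suc j)
  define G where "G i d = (if \<forall>l\<in>#d. i \<le> l then F (add_mset i d) else 0)" for i d
  have G: "G i \<in> mps_carrier n" for i
    using Suc.prems(1) unfolding G_def by clarsimp (metis insert_subset set_mset_add_mset_insert subsetD
      atLeastAtMost_iff One_nat_def)
  have IH: "ev (G i) \<in> ideal_pow (fps_ring S) I j" for i
    by (rule Suc.IH[OF G]) (auto simp: G_def Suc.prems(2))
  have "F d = (\<Sum>i\<in>{1..n}. mps_mult (mps_var i) (G i) d)" for d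
  proof (cases "d = {#}")
    case True
    then show ?thesis
      using Suc.prems(2)[of "{#}"] unfolding True mps_mult_var by simp
  next
    case False
    have *: "mps_mult (mps_var i) (G i) d = (if i = Min_mset d then F d else 0)" for i
    proof (cases "i \<in># d")
      case True
      have "(\<forall>l\<in>#d - {#i#}. i \<le> l) \<longleftrightarrow> i = Min_mset d"
      proof
        assume le: "\<forall>l\<in>#d - {#i#}. i \<le> l"
        have "i \<le> l" if "l \<in># d" for l
          using that le True by (metis insert_DiffM insert_noteq_member order_refl)
        then show "i = Min_mset d"
          using True by (intro Min_eqI[symmetric]) auto
      qed (auto intro: Min_le dest: in_diffD)
      then show ?thesis
        using True insert_DiffM[OF True] unfolding mps_mult_var by (auto simp: G_def)
    next
      case F: False
      then have "i \<noteq> Min_mset d"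
        using Min_in[of "set_mset d"] False by auto
      with F show ?thesis
        unfolding mps_mult_var by simp
    qed
    show ?thesis
    proof (cases "F d = 0")
      case False
      then have "Min_mset d \<in> {1..n}"
        using Suc.prems(1) \<open>d \<noteq> {#}\<close> by (metis (mono_tags, lifting) Min_in finite_set_mset
            mem_Collect_eq set_mset_eq_empty_iff subsetD)
      then show ?thesis
        unfolding * by simp
    qed (simp add: *)
  qed
  then have F_eq: "F = (\<lambda>d. \<Sum>i\<in>{1..n}. mps_mult (mps_var i) (G i) d)"
    by blast
  have "ev F = (\<Sum>i\<in>{1..n}. ev (mps_mult (mps_var i) (G i)))"
    by (subst F_eq, rule ev_sum) simp
  also have "\<dots> = (\<Sum>i\<in>{1..n}. ev (G i) * x i)"
    by (intro sum.cong refl, subst ev_mult, subst ev_var) (simp_all add: mult.commute)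
  also have "\<dots> \<in> ideal_prod (fps_ring S) (ideal_pow (fps_ring S) I j) I"
  proof -
    \<comment> \<open>\<open>ideal_prod\<close> is generated by products and binary sums, with no
      clause for zero, whence the nonempty index set and the appeal to \<open>n_pos\<close>.\<close>
    have sums: "sum g A \<in> ideal_prod (fps_ring S) J I"
      if "finite A" "A \<noteq> {}" "\<And>i. i \<in> A \<Longrightarrow> g i \<in> ideal_prod (fps_ring S) J I" for A J and g :: "nat \<Rightarrow> _"
      using that
    proof (induction A rule: finite_ne_induct)
      case (insert a A)
      then show ?case
        using ideal_prod.sum[of "g a" "fps_ring S" J I "sum g A"] by (simp add: fps_ring_def)
    qed simp
    have prods: "ev (G i) * x i \<in> ideal_prod (fps_ring S) (ideal_pow (fps_ring S) I j) I"
      if "i \<in> {1..n}" for i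
    proof -
      have "x i \<in> I"
        using I that by blast
      from ideal_prod.prod[OF IH this, of "fps_ring S"] show ?thesis
        by (simp add: fps_ring_def)
    qed
    show ?thesis
      by (rule sums) (use prods n_pos in auto)
  qed
  finally show ?case
    by (simp add: ideals_set_def)
qed

end

section \<open>Torsion-free differentials\<close>

locale mps_curve_torsion_free = mps_curve n x S m e f
  for n and x :: "nat \<Rightarrow> 'k::field_char_0 fps" and S m e f +
  assumes syzygy_rels:
    "\<And>v. (\<And>i. i \<in> {1..n} \<Longrightarrow> v i \<in> S) \<Longrightarrow> (\<Sum>i\<in>{1..n}. v i * fps_XD (x i)) = 0 \<Longrightarrow> v \<in> rels"
begin

text \<open>The symmetry of second derivatives kills the \<open>\<Lambda>\<^sub>i\<^sub>j\<close>, and comparing a lift of \<open>h\<close>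
  with its image under the Euler operator \<open>\<Sum> X\<^sub>i \<partial>\<^sub>i\<close> removes its cubic part.\<close>

lemma exact_combination:
  fixes \<Lambda> :: "nat \<Rightarrow> nat \<Rightarrow> 'k"
  assumes h: "h \<in> S" "h $ 0 = 0" and g: "\<And>i. i \<in> {1..n} \<Longrightarrow> g i \<in> S" and \<rho>: "\<rho> \<in> S"
    and eq: "(\<Sum>j\<in>{1..n}. (\<Sum>i\<in>{2..<j}. fps_const (\<Lambda> i j) * x i) * fps_XD (x j)) =
      fps_XD h + x 1 * (\<Sum>i\<in>{1..n}. g i * fps_XD (x i)) + \<rho> * fps_XD (x 1)"
  shows "\<And>i j. j \<in> {2..n} \<Longrightarrow> i \<in> {2..<j} \<Longrightarrow> \<Lambda> i j = 0"
    and "\<exists>F\<in>mps_carrier n. (\<forall>d. size d < 4 \<longrightarrow> F d = 0) \<and> (\<exists>s\<in>S. h = ev F + x 1 * s)"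
proof -
  obtain H where H: "H \<in> mps_carrier n" "ev H = h"
    using lift[OF h(1)] by blast
  \<comment> \<open>The difference of the coefficient vectors of the two sides of \<open>eq\<close>,
    with the gradient of \<open>H\<close> representing \<delta>h. It is a syzygy, hence the gradient
    of a relation.\<close>
  define v where "v j = (\<Sum>i\<in>{2..<j}. fps_const (\<Lambda> i j) * x i) - grad H j - x 1 * g j - (if j = 1 then \<rho> else 0)"
    for j
  have x1: "x 1 \<in> S"
    using S_x n_pos by simp
  have "v \<in> rels"
  proof (rule syzygy_rels)
    fix j assume j: "j \<in> {1..n}"
    then have "(\<Sum>i\<in>{2..<j}. fps_const (\<Lambda> i j) * x i) \<in> S"
      by (intro S_sum S_mult S_const S_x) auto
    then show "v j \<in> S"
      unfolding v_def using j x1 g \<rho> grad_closed[OF H(1)]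
      by (intro S_diff S_mult) (auto simp: S_0)
  next
    have "(\<Sum>j\<in>{1..n}. v j * fps_XD (x j)) =
      (\<Sum>j\<in>{1..n}. (\<Sum>i\<in>{2..<j}. fps_const (\<Lambda> i j) * x i) * fps_XD (x j)) - fps_XD (ev H)
      - x 1 * (\<Sum>j\<in>{1..n}. g j * fps_XD (x j)) - (\<Sum>j\<in>{1..n}. if j = 1 then \<rho> * fps_XD (x 1) else 0)"
      unfolding v_def XD_ev sum_distrib_left sum_subtractf[symmetric]
      by (rule sum.cong) (auto simp: left_diff_distrib mult.assoc)
    then show "(\<Sum>j\<in>{1..n}. v j * fps_XD (x j)) = 0"
      using eq n_pos by (simp add: H(2))
  qed
  then obtain F where F: "F \<in> mps_carrier n" "ev F = 0" "\<forall>j\<in>{1..n}. v j = grad F j"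
    unfolding rels_def by blast
  \<comment> \<open>Adding this relation yields another lift of \<open>h\<close>, whose partial
    derivatives for j \<ge> 2 evaluate to the prescribed linear forms up to multiples of
    x_1.\<close>
  define G where "G d = H d + F d" for d
  have G: "G \<in> mps_carrier n" "ev G = h"
    using mps_carrier_add[OF H(1) F(1)] H F by (simp_all add: G_def[abs_def] ev_add)
  have grad_G: "grad G j = (\<Sum>i\<in>{2..<j}. fps_const (\<Lambda> i j) * x i) - x 1 * g j" if "j \<in> {2..n}" for j
  proof -
    have "grad G j = grad H j + v j"
      using that F(3) by (simp add: G_def[abs_def] grad_add)
    then show ?thesis
      using that by (simp add: v_def)
  qed
  have pderiv_G: "mps_pderiv j G d = (\<Sum>i\<in>{2..<j}. if d = {#i#} then \<Lambda> i j else 0)"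
    if j: "j \<in> {2..n}" and d: "size d < 2" "1 \<notin># d" for j d
  proof -
    have "g j \<in> S"
      using g j by simp
    then obtain L where L: "L \<in> mps_carrier n" "ev L = g j"
      using lift by blast
    define A where "A i = (\<lambda>d :: nat multiset. if d = {#i#} then \<Lambda> i j else 0)" for i
    have A: "A i \<in> mps_carrier n" "ev (A i) = fps_const (\<Lambda> i j) * x i" if "i \<in> {2..<j}" for i
      using that j mps_carrier_single[of "{#i#}" n "\<Lambda> i j"] ev_single[of "{#i#}" "\<Lambda> i j"]
      by (auto simp: A_def mon_def)
    define B where "B d = (\<Sum>i\<in>{2..<j}. A i d)" for d
    have B: "B \<in> mps_carrier n"
      unfolding B_def by (rule mps_carrier_sum) (rule A)
    \<comment> \<open>An equality of values becomes one of coefficients: \<open>E\<close> is a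
      relation, so its terms of degree below two vanish. The last summand is invisible at monomials
      without X_1.\<close>
    define E where "E d = (mps_pderiv j G d - B d) + mps_mult (mps_var 1) L d" for d
    have "ev B = (\<Sum>i\<in>{2..<j}. fps_const (\<Lambda> i j) * x i)"
      unfolding B_def by (subst ev_sum) (use A in auto)
    then have "ev E = 0"
      using grad_G[OF j] ev_var[of 1] n_pos
      by (simp add: E_def[abs_def] ev_add ev_diff ev_mult L grad_def)
    moreover have "E \<in> mps_carrier n"
      unfolding E_def using G L B n_pos
      by (intro mps_carrier_add mps_carrier_diff mps_mult_closed mps_pderiv_closed mps_var_carrier) auto
    ultimately have "E d = 0"
      using order_two d(1) by blast
    then show ?thesis
      using d(2) by (simp add: E_def mps_mult_var B_def A_def)
  qed
  have linear: "G {#j#} = 0" if "j \<in> {2..n}" for j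
    using pderiv_G[OF that, of "{#}"] by (simp add: mps_pderiv_def)
  have quadratic: "of_nat (Suc (count {#l#} j)) * G {#j, l#} = (if l < j then \<Lambda> l j else 0)"
    if "j \<in> {2..n}" "l \<in> {2..n}" for j l
    using pderiv_G[OF that(1), of "{#l#}"] that by (simp add: mps_pderiv_def)
  \<comment> \<open>The coefficient of X_i X_j is read off from both derivatives: the one by X_j
    shows \<Lambda>, while the one by X_i shows zero, as its linear form involves only indices below
    \<open>i\<close>.\<close>
  have "\<Lambda> i j = 0" if "j \<in> {2..n}" "i \<in> {2..<j}" for i j
    using quadratic[of i j] quadratic[of j i] that by (simp add: add_mset_commute)
  then show coeffs_0: "\<And>i j. j \<in> {2..n} \<Longrightarrow> i \<in> {2..<j} \<Longrightarrow> \<Lambda> i j = 0" .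
  have quad0: "G {#j, l#} = 0" if "j \<in> {2..n}" "l \<in> {2..n}" for j l
  proof -
    have "of_nat (Suc (count {#l#} j)) * G {#j, l#} = 0"
      unfolding quadratic[OF that] using that by (auto intro!: coeffs_0)
    then show ?thesis
      by (metis mult_eq_0_iff of_nat_eq_0_iff nat.distinct(1))
  qed
  have "ev G $ 0 = G {#}"
  proof -
    have "monomials 0 = {{#}}"
      by (auto simp: mem_monomials)
    then show ?thesis
      by (simp add: ev_nth[of 0 0] mon_def)
  qed
  then have const: "G {#} = 0"
    using G(2) h(2) by simp
  \<comment> \<open>The factor 1/3 is chosen to make degree three vanish. What is left is
    \<open>F4\<close> together with the multiples of X_1 of degree below three, which
    \<open>Q\<close> collects after division by X_1.\<close>
  define L where "L d = (1 - of_nat (size d) / 3) * G d" for d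
  define F4 where "F4 d = (if 4 \<le> size d then L d else 0)" for d
  define Q where "Q d = (if size d < 2 then L (add_mset 1 d) else 0)" for d
  have L0: "L d = 0" if "1 \<notin># d" "size d < 3" for d
  proof (cases "G d = 0")
    case False
    then have sub: "set_mset d \<subseteq> {1..n}"
      using G(1) by blast
    have in_d: "l \<in> {2..n}" if "l \<in># d" for l
      using that sub \<open>1 \<notin># d\<close> by (cases "l = 1") (auto simp: subset_iff)
    consider "size d = 0" | "size d = Suc 0" | "size d = Suc (Suc 0)"
      using \<open>size d < 3\<close> by linarith
    then show ?thesis
    proof cases
      case 1
      then show ?thesis using const by (simp add: L_def)
    next
      case 2
      then obtain j where "d = {#j#}"
        using size_1_singleton_mset by auto
      then show ?thesis using linear[of j] in_d[of j] by (simp add: L_def)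
    next
      case 3
      then obtain j d' where d': "d = add_mset j d'"
        using size_eq_Suc_imp_eq_union by blast
      with 3 obtain l where "d' = {#l#}"
        using size_1_singleton_mset[of d'] by auto
      with d' have "d = {#j, l#}"
        by simp
      then show ?thesis using quad0[of j l] in_d[of j] in_d[of l] by (simp add: L_def)
    qed
  qed (simp add: L_def)
  have L_split: "L = (\<lambda>d. F4 d + mps_mult (mps_var 1) Q d)"
  proof
    fix d :: "nat multiset"
    consider "4 \<le> size d" | "size d = 3" | "size d < 3"
      by linarith
    then show "L d = F4 d + mps_mult (mps_var 1) Q d"
    proof cases
      case 2
      then have "L d = 0"
        by (simp add: L_def)
      then show ?thesis
        using 2 unfolding mps_mult_var by (simp add: F4_def Q_def size_Diff_singleton)
    next
      case 3
      then show ?thesis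
        using L0[of d] unfolding mps_mult_var by (auto simp: F4_def Q_def size_Diff_singleton)
    next
      case 1
      then show ?thesis
        unfolding mps_mult_var by (auto simp: F4_def Q_def size_Diff_singleton)
    qed
  qed
  have L_carrier: "L \<in> mps_carrier n"
    using G(1) by (auto simp: L_def)
  have F4: "F4 \<in> mps_carrier n"
    using L_carrier by (auto simp: F4_def split: if_splits)
  have Q: "Q \<in> mps_carrier n"
    using L_carrier unfolding Q_def
    by clarsimp (metis insert_subset set_mset_add_mset_insert subsetD atLeastAtMost_iff One_nat_def)
  have euler: "of_nat (size d) * G d = (\<Sum>i\<in>{1..n}. mps_mult (mps_var i) (mps_pderiv i G) d)" for d
  proof (cases "G d = 0")
    case True
    have "mps_mult (mps_var i) (mps_pderiv i G) d = 0" for i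
      unfolding mps_mult_var using True by (simp add: mps_pderiv_def)
    then show ?thesis
      using True by simp
  next
    case False
    then have sub: "set_mset d \<subseteq> {1..n}"
      using G(1) by blast
    have "mps_mult (mps_var i) (mps_pderiv i G) d = of_nat (count d i) * G d" for i
      unfolding mps_mult_var by (auto simp: mps_pderiv_def not_in_iff)
    moreover have "size d = (\<Sum>i\<in>{1..n}. count d i)"
      unfolding size_multiset_overloaded_eq using sub
      by (intro sum.mono_neutral_left) (auto simp: not_in_iff)
    ultimately show ?thesis
      by (simp add: sum_distrib_right)
  qed
  have third: "fps_const (1/3) * ev (\<lambda>d. of_nat (size d) * G d) = h - ev L"
    unfolding ev_smult[symmetric] G(2)[symmetric] ev_diff[symmetric]
    by (simp add: L_def algebra_simps)
  have "ev (\<lambda>d. of_nat (size d) * G d) = (\<Sum>i\<in>{1..n}. x i * grad G i)"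
    unfolding euler by (subst ev_sum) (auto simp: ev_mult ev_var[simplified] grad_def intro!: sum.cong)
  also have "\<dots> = x 1 * grad G 1 + (\<Sum>i\<in>{2..n}. x i * grad G i)"
    using n_pos by (simp add: sum.atLeast_Suc_atMost numeral_2_eq_2)
  \<comment> \<open>With the \<Lambda> gone, all derivatives but the first are multiples of x_1, so
    the Euler operator changes \<open>h\<close> only by a multiple of x_1.\<close>
  also have "(\<Sum>i\<in>{2..n}. x i * grad G i) = x 1 * (\<Sum>i\<in>{2..n}. - (x i * g i))"
    unfolding sum_distrib_left using coeffs_0 by (intro sum.cong) (auto simp: grad_G)
  finally have "ev (\<lambda>d. of_nat (size d) * G d) = x 1 * (grad G 1 + (\<Sum>i\<in>{2..n}. - (x i * g i)))"
    by (simp add: distrib_left)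
  moreover define s where "s = ev Q + fps_const (1/3) * (grad G 1 + (\<Sum>i\<in>{2..n}. - (x i * g i)))"
  moreover have "ev L = ev F4 + x 1 * ev Q"
    unfolding L_split using n_pos by (simp add: ev_add ev_mult ev_var)
  ultimately have "h = ev F4 + x 1 * s"
    using third by (simp add: algebra_simps)
  moreover have "s \<in> S"
    unfolding s_def using grad_closed[OF G(1)] S_ev[OF Q]
    by (intro S_add S_mult S_const S_sum S_uminus S_x g) auto
  ultimately show "\<exists>F\<in>mps_carrier n. (\<forall>d. size d < 4 \<longrightarrow> F d = 0) \<and> (\<exists>s\<in>S. h = ev F + x 1 * s)"
    using F4 by (intro bexI[of _ F4]) (auto simp: F4_def)
qed

end

section \<open>Bases modulo a parameter\<close>

interpretation fps_vs: vector_space "\<lambda>c f. fps_const c * (f :: 'k::field fps)"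
  by unfold_locales (auto simp: algebra_simps fps_const_add[symmetric] simp del: fps_const_add)

text \<open>The first clause supplies the entries of a linear system with unknowns
  \<open>c k\<close>. The second says that \<open>d\<close> equations detect membership in
  \<open>W\<close> for elements whose class lies in the span of the \<open>b i\<close>.\<close>

lemma fps_functionals:
  fixes W :: "'k::field fps set" and b :: "nat \<Rightarrow> 'k fps"
  assumes "fps_vs.subspace W"
  shows "\<exists>\<phi>.
    (\<forall>i A c Z. \<phi> i (\<Sum>k\<in>A. fps_const (c k) * Z k) = (\<Sum>k\<in>A. \<phi> i (Z (k :: 'z)) * c k :: 'k)) \<and>
    (\<forall>y c. y - (\<Sum>i<d. fps_const (c i) * b i) \<in> W \<longrightarrow> (\<forall>i<d. \<phi> i y = 0) \<longrightarrow> y \<in> W)"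
proof -
  from fps_vs.separating_functionals[OF assms, of d b]
  obtain \<phi> :: "nat \<Rightarrow> 'k fps \<Rightarrow> 'k"
    where lin: "\<And>i. Vector_Spaces.linear (\<lambda>c f. fps_const c * f) (*) (\<phi> i)"
    and sep: "\<And>c w. w \<in> W \<Longrightarrow> \<forall>i<d. \<phi> i ((\<Sum>i<d. fps_const (c i) * b i) + w) = 0 \<Longrightarrow>
      (\<Sum>i<d. fps_const (c i) * b i) + w \<in> W"
    by blast
  show ?thesis
  proof (intro exI[of _ \<phi>] conjI allI impI)
    fix i and A :: "'z set" and c Z
    interpret Vector_Spaces.linear "\<lambda>c f. fps_const c * f" "(*)" "\<phi> i"
      by (rule lin)
    show "\<phi> i (\<Sum>k\<in>A. fps_const (c k) * Z k) = (\<Sum>k\<in>A. \<phi> i (Z k) * c k)"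
      by (simp only: sum scale) (simp add: mult.commute)
  next
    fix y c assume "y - (\<Sum>i<d. fps_const (c i) * b i) \<in> W" "\<forall>i<d. \<phi> i y = 0"
    then show "y \<in> W"
      using sep[of "y - (\<Sum>i<d. fps_const (c i) * b i)" c] by simp
  qed
qed

text \<open>The \<open>d j\<close> have, up to scaling, the elements of the Apery set of the value set of \<open>D\<close> as orders.\<close>

lemma apery_basis:
  fixes D :: "'k::field fps set"
  assumes e: "1 \<le> e" and D_add: "\<And>v w. v \<in> D \<Longrightarrow> w \<in> D \<Longrightarrow> v + w \<in> D"
    and D_smult: "\<And>c w. w \<in> D \<Longrightarrow> fps_const c * w \<in> D"
    and D_shift: "\<And>w. w \<in> D \<Longrightarrow> fps_X ^ e * w \<in> D"
    and D_conductor: "\<And>g. (\<forall>k<N. g $ k = 0) \<Longrightarrow> g \<in> D"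
  shows "\<exists>d. (\<forall>j<e. d j \<in> D \<and> (\<forall>k<j. d j $ k = 0)) \<and>
    (\<forall>y\<in>D. \<exists>c. y - (\<Sum>j<e. fps_const (c j) * d j) \<in> (*) (fps_X ^ e) ` D) \<and>
    (\<forall>c. (\<Sum>j<e. fps_const (c j) * d j) \<in> (*) (fps_X ^ e) ` D \<longrightarrow> (\<forall>j<e. c j = 0))"
proof -
  define lead where "lead v \<longleftrightarrow> (\<exists>y\<in>D. (\<forall>k<v. y $ k = 0) \<and> y $ v = 1)" for v
  have leadI: "lead v" if "y \<in> D" "\<forall>k<v. y $ k = 0" "y $ v \<noteq> 0" for y v
    unfolding lead_def using that D_smult[OF that(1), of "inverse (y $ v)"]
    by (intro bexI[of _ "fps_const (inverse (y $ v)) * y"]) auto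
  define w where "w j = (LEAST v. lead v \<and> v mod e = j)" for j
  \<comment> \<open>This exponent has residue \<open>j\<close> and is at least \<open>N\<close>, so
    every residue class contains the order of an element of \<open>D\<close>.\<close>
  have ex: "lead (j + e * N) \<and> (j + e * N) mod e = j" if "j < e" for j
  proof -
    have "N \<le> j + e * N"
      using e by (simp add: trans_le_add2)
    then have "lead (j + e * N)"
      by (intro leadI[of "fps_X ^ (j + e * N)"] D_conductor) (auto simp: fps_X_power_nth)
    then show ?thesis
      using that by simp
  qed
  have w: "lead (w j)" "w j mod e = j" if "j < e" for j
    using LeastI[of "\<lambda>v. lead v \<and> v mod e = j", OF ex[OF that]] by (auto simp: w_def)
  have w_le: "w (v mod e) \<le> v" if "lead v" for v
    unfolding w_def by (rule Least_le) (use that in simp)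
  have "\<forall>j. \<exists>y. j < e \<longrightarrow> y \<in> D \<and> (\<forall>k<w j. y $ k = 0) \<and> y $ w j = 1"
    using w(1) unfolding lead_def by blast
  then obtain d where d: "\<And>j. j < e \<Longrightarrow> d j \<in> D" "\<And>j k. j < e \<Longrightarrow> k < w j \<Longrightarrow> d j $ k = 0"
    "\<And>j. j < e \<Longrightarrow> d j $ w j = 1"
    by metis
  have shift: "fps_X ^ (e * q) * y \<in> D" if "y \<in> D" for q y
    using that by (induction q) (simp_all add: power_add mult.assoc D_shift)
  let ?W = "(*) (fps_X ^ e) ` D"
  \<comment> \<open>Downward induction on the order. It starts at \<open>N + e\<close>, where
    division by t^e still leaves order \<open>N\<close>. A leading term is removed by t^(eq) times
    some \<open>d j\<close>: for q = 0 this changes the coefficient \<open>c j\<close>, for q > 0 it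
    changes the part in \<open>?W\<close>.\<close>
  have span: "\<forall>y\<in>D. (\<forall>k<0. y $ k = 0) \<longrightarrow> (\<exists>c. y - (\<Sum>j<e. fps_const (c j) * d j) \<in> ?W)"
  proof (rule inc_induct[of 0 "N + e"])
    show "\<forall>y\<in>D. (\<forall>k<N + e. y $ k = 0) \<longrightarrow> (\<exists>c. y - (\<Sum>j<e. fps_const (c j) * d j) \<in> ?W)"
    proof (intro ballI impI exI)
      fix y :: "'k fps" assume "\<forall>k<N + e. y $ k = 0"
      then have "fps_shift e y \<in> D" "y = fps_X ^ e * fps_shift e y"
        by (auto intro!: D_conductor fps_ext simp: fps_X_power_mult_nth)
      then show "y - (\<Sum>j<e. fps_const ((\<lambda>_. 0) j) * d j) \<in> ?W"
        by simp
    qed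
  next
    fix v assume IH: "\<forall>y\<in>D. (\<forall>k<Suc v. y $ k = 0) \<longrightarrow> (\<exists>c. y - (\<Sum>j<e. fps_const (c j) * d j) \<in> ?W)"
    show "\<forall>y\<in>D. (\<forall>k<v. y $ k = 0) \<longrightarrow> (\<exists>c. y - (\<Sum>j<e. fps_const (c j) * d j) \<in> ?W)"
    proof (intro ballI impI)
      fix y assume y: "y \<in> D" "\<forall>k<v. y $ k = 0"
      define j where "j = v mod e"
      have j: "j < e"
        using e by (simp add: j_def)
      show "\<exists>c. y - (\<Sum>j<e. fps_const (c j) * d j) \<in> ?W"
      proof (cases "y $ v = 0")
        case True
        with y IH show ?thesis
          by (simp add: less_Suc_eq)
      next
        case False
        then have "w j \<le> v"
          unfolding j_def by (intro w_le leadI[OF y])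
        moreover have "w j mod e = v mod e"
          using w(2)[OF j] j_def by simp
        ultimately obtain q where q: "v = w j + e * q"
          by (metis add.commute le_add_diff_inverse2 mod_eq_dvd_iff_nat dvdE)
        define u where "u = fps_X ^ (e * q) * d j"
        have u: "u \<in> D" "\<forall>k<v. u $ k = 0" "u $ v = 1"
          using d[OF j] d(2)[OF j] shift q by (auto simp: u_def fps_X_power_mult_nth)
        define z where "z = y + fps_const (- (y $ v)) * u"
        have z: "z \<in> D"
          unfolding z_def by (intro D_add D_smult y u)
        moreover have "\<forall>k<Suc v. z $ k = 0"
          using y u by (auto simp: z_def less_Suc_eq)
        ultimately obtain c where "z - (\<Sum>j<e. fps_const (c j) * d j) \<in> ?W"
          using IH by blast
        then obtain s where s: "s \<in> D" "z - (\<Sum>j<e. fps_const (c j) * d j) = fps_X ^ e * s"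
          by blast
        have zu: "z = y - fps_const (y $ v) * u"
          by (simp add: z_def flip: fps_const_neg)
        show ?thesis
        proof (cases q)
          case 0
          define c' where "c' = c(j := c j + y $ v)"
          have "(\<Sum>i<e. fps_const (c' i) * d i) =
              (\<Sum>i<e. fps_const (c i) * d i + (if i = j then fps_const (y $ v) * d j else 0))"
            by (rule sum.cong) (auto simp: c'_def distrib_right simp flip: fps_const_add)
          also have "\<dots> = (\<Sum>i<e. fps_const (c i) * d i) + fps_const (y $ v) * d j"
            using j by (simp add: sum.distrib)
          finally have "y - (\<Sum>i<e. fps_const (c' i) * d i) = fps_X ^ e * s"
            unfolding s(2)[symmetric] zu using 0 by (simp add: u_def)
          then show ?thesis
            using s(1) by blast
        next
          case (Suc q')
          have "y - (\<Sum>j<e. fps_const (c j) * d j) =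
              (z - (\<Sum>j<e. fps_const (c j) * d j)) + fps_const (y $ v) * u"
            unfolding zu by simp
          also have "\<dots> = fps_X ^ e * (s + fps_const (y $ v) * (fps_X ^ (e * q') * d j))"
            unfolding s(2) using Suc by (simp add: u_def algebra_simps power_add)
          finally have "y - (\<Sum>j<e. fps_const (c j) * d j) =
              fps_X ^ e * (s + fps_const (y $ v) * (fps_X ^ (e * q') * d j))" .
          moreover have "s + fps_const (y $ v) * (fps_X ^ (e * q') * d j) \<in> D"
            using s d(1)[OF j] by (intro D_add D_smult shift)
          ultimately show ?thesis
            by blast
        qed
      qed
    qed
  qed simp
  \<comment> \<open>The \<open>w j\<close> are pairwise distinct, so the least one with
    \<open>c j\<close> nonzero is the order of the sum. If the sum were in \<open>?W\<close>, then
    \<open>w j - e\<close> would be an order in the same residue class, against the choice of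
    \<open>w j\<close>.\<close>
  have indep: "\<forall>j<e. c j = 0" if sum: "(\<Sum>j<e. fps_const (c j) * d j) \<in> ?W" for c
  proof (rule ccontr)
    assume "\<not> (\<forall>j<e. c j = 0)"
    then obtain j where j: "j < e" "c j \<noteq> 0" and min: "\<And>i. i < e \<Longrightarrow> c i \<noteq> 0 \<Longrightarrow> w j \<le> w i"
      using ex_has_least_nat[of "\<lambda>j. j < e \<and> c j \<noteq> 0" _ w] by blast
    obtain y where y: "y \<in> D" "(\<Sum>j<e. fps_const (c j) * d j) = fps_X ^ e * y"
      using sum by blast
    have coeff: "(fps_X ^ e * y) $ k = (if k = w j then c j else 0)" if "k \<le> w j" for k
    proof -
      have "c i * d i $ k = (if i = j then (if k = w j then c j else 0) else 0)" if "i < e" for i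
      proof (cases "i = j \<or> c i = 0")
        case True
        then show ?thesis
          using d(2)[OF j(1), of k] d(3)[OF j(1)] \<open>k \<le> w j\<close> j by (cases "k = w j") auto
      next
        case False
        then have "w j \<noteq> w i"
          using w(2)[OF that] w(2)[OF j(1)] by auto
        then have "k < w i"
          using min[OF that] False \<open>k \<le> w j\<close> by auto
        then show ?thesis
          using d(2)[OF that] False by simp
      qed
      then have "(\<Sum>i<e. c i * d i $ k) = (if k = w j then c j else 0)"
        using j(1) by simp
      then show ?thesis
        unfolding y(2)[symmetric] by (simp add: fps_sum_nth)
    qed
    have "e \<le> w j"
      using coeff[of "w j"] j(2) by (auto simp: fps_X_power_mult_nth split: if_splits)
    then have "lead (w j - e)"
    proof (intro leadI[OF y(1)] allI impI)
      fix k assume "k < w j - e"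
      then show "y $ k = 0"
        using coeff[of "k + e"] by (auto simp: fps_X_power_mult_nth)
    next
      show "y $ (w j - e) \<noteq> 0"
        using coeff[of "w j"] j(2) \<open>e \<le> w j\<close> by (auto simp: fps_X_power_mult_nth)
    qed
    then have "w ((w j - e) mod e) \<le> w j - e"
      by (rule w_le)
    moreover have "(w j - e) mod e = j"
      using \<open>e \<le> w j\<close> w(2)[OF j(1)] by (simp add: le_mod_geq)
    ultimately show False
      using e \<open>e \<le> w j\<close> by simp
  qed
  have "d j $ k = 0" if "j < e" "k < j" for j k
  proof -
    have "j \<le> w j"
      using w(2)[OF that(1)] by (metis mod_less_eq_dividend)
    then show ?thesis
      using d(2) that by simp
  qed
  with d(1) span indep show ?thesis
    by (intro exI[of _ d]) simp
qed

text \<open>The library builds dimension by successive line extensions; collecting a representative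
  of each added vector gives \<open>r\<close> elements that span \<open>J\<close> modulo
  \<open>I\<close>.\<close>

lemma quotient_dim_spanning:
  assumes I: "ideal I (fps_ring S)" and J: "J \<subseteq> S" and const: "range fps_const \<subseteq> S"
    and dim: "quotient_dim S J I r"
  shows "\<exists>b. \<forall>y\<in>J. \<exists>c. y - (\<Sum>i<r. fps_const (c i) * b i) \<in> I"
proof -
  interpret ideal I "fps_ring S"
    by (rule I)
  interpret Q: ring "fps_ring S Quot I"
    by (rule quotient_is_ring)
  have simps: "carrier (fps_ring S) = S" "a \<otimes>\<^bsub>fps_ring S\<^esub> b = a * b" "a \<oplus>\<^bsub>fps_ring S\<^esub> b = a + b"
    "\<zero>\<^bsub>fps_ring S\<^esub> = 0" for a b
    by (simp_all add: fps_ring_def)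
  let ?cos = "\<lambda>a. I +>\<^bsub>fps_ring S\<^esub> a"
  have add: "?cos (a + b) = ?cos a \<oplus>\<^bsub>fps_ring S Quot I\<^esub> ?cos b"
    and mult: "?cos (a * b) = ?cos a \<otimes>\<^bsub>fps_ring S Quot I\<^esub> ?cos b" if "a \<in> S" "b \<in> S" for a b
    using that ring_hom_add[OF rcos_ring_hom, of a b] ring_hom_mult[OF rcos_ring_hom, of a b]
    by (simp_all add: simps)
  have scale: "fps_const c * a \<in> S" if "a \<in> S" for a c
    using m_closed[of "fps_const c" a] const that by (auto simp: simps)
  have comb: "(\<Sum>i<d. fps_const (c i) * b i) \<in> S" if "\<And>i. i < d \<Longrightarrow> b i \<in> S" for b c and d :: nat
    using that
  proof (induction d)
    case 0
    then show ?case
      using zero_closed by (simp add: simps)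
  next
    case (Suc d)
    then show ?case
      using a_closed[of "\<Sum>i<d. fps_const (c i) * b i" "fps_const (c d) * b d"] scale
      by (simp add: simps)
  qed
  have "\<exists>b. (\<forall>i<r. b i \<in> S) \<and> (\<forall>A\<in>E. \<exists>c. A = ?cos (\<Sum>i<r. fps_const (c i) * b i))"
    if "Q.dimension r K E" "K = (\<lambda>c. ?cos (fps_const c)) ` UNIV" for K E
    using that
  proof (induction rule: Q.dimension.induct)
    case (zero_dim K)
    have "\<zero>\<^bsub>fps_ring S Quot I\<^esub> = ?cos 0"
      using a_rcos_const[of 0] zero_closed additive_subgroup.zero_closed[OF is_additive_subgroup]
      by (simp add: FactRing_def simps)
    then show ?case
      by simp
  next
    case (Suc_dim v E r K)
    then obtain b where b: "\<And>i. i < r \<Longrightarrow> b i \<in> S"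
      "\<And>A. A \<in> E \<Longrightarrow> \<exists>c. A = ?cos (\<Sum>i<r. fps_const (c i) * b i)"
      by blast
    obtain a where a: "a \<in> S" "v = ?cos a"
      using Suc_dim.hyps(1) by (auto simp: FactRing_def A_RCOSETS_def RCOSETS_def a_r_coset_def simps)
    define b' where "b' = b(r := a)"
    have b': "b' i \<in> S" if "i < Suc r" for i
      using that b(1) a(1) by (auto simp: b'_def less_Suc_eq)
    have "\<exists>c. A = ?cos (\<Sum>i<Suc r. fps_const (c i) * b' i)" if A: "A \<in> Q.line_extension K v E" for A
    proof -
      obtain k B where k: "B \<in> E"
        "A = ?cos (fps_const k) \<otimes>\<^bsub>fps_ring S Quot I\<^esub> ?cos a \<oplus>\<^bsub>fps_ring S Quot I\<^esub> B"
        using A Suc_dim.prems a(2) unfolding Q.line_extension_mem_iff by blast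
      obtain c where c: "B = ?cos (\<Sum>i<r. fps_const (c i) * b i)"
        using b(2) k(1) by blast
      have sum: "(\<Sum>i<r. fps_const (c i) * b i) \<in> S"
        by (rule comb) (rule b(1))
      have "A = ?cos (fps_const k * a + (\<Sum>i<r. fps_const (c i) * b i))"
        unfolding k c add[OF scale[OF a(1)] sum] mult[OF const[THEN subsetD, OF rangeI] a(1)]
        by (rule refl)
      also have "fps_const k * a + (\<Sum>i<r. fps_const (c i) * b i) =
          (\<Sum>i<Suc r. fps_const ((c(r := k)) i) * b' i)"
        by (simp add: b'_def)
      finally show ?thesis
        by blast
    qed
    with b' show ?case
      by blast
  qed
  from this[OF dim[unfolded quotient_dim_def] refl]
  obtain b where b: "\<And>i. i < r \<Longrightarrow> b i \<in> S"
    "\<And>y. y \<in> J \<Longrightarrow> \<exists>c. ?cos y = ?cos (\<Sum>i<r. fps_const (c i) * b i)"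
    by blast
  have "\<exists>c. y - (\<Sum>i<r. fps_const (c i) * b i) \<in> I" if y: "y \<in> J" for y
  proof -
    obtain c where "?cos y = ?cos (\<Sum>i<r. fps_const (c i) * b i)"
      using b(2)[OF y] by blast
    moreover have "y \<in> ?cos y"
      using y J by (intro a_rcos_self) (auto simp: simps)
    ultimately obtain h where "h \<in> I" "y = h + (\<Sum>i<r. fps_const (c i) * b i)"
      by (auto simp: a_r_coset_def r_coset_def simps)
    then show ?thesis
      by (intro exI[of _ c]) simp
  qed
  then show ?thesis
    by blast
qed

lemma card_triangle:
  assumes "1 \<le> n"
  shows "card (SIGMA j:{2..n}. {2..<j}) = (n - 1) choose 2"
proof -
  have "card (SIGMA j:{2..n}. {2..<j}) = (\<Sum>j\<in>{2..n}. j - 2)"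
    by simp
  also have "\<dots> = (n - 1) choose 2"
    using assms
  proof (induction n rule: nat_induct_at_least)
    case (Suc n)
    then show ?case
    proof (cases n)
      case (Suc k)
      then show ?thesis
        using Suc.IH by (cases k) (auto simp: numeral_2_eq_2)
    qed simp
  qed simp
  finally show ?thesis .
qed

lemma (in mps_curve) cring_fps_ring: "cring (fps_ring S)"
proof (rule cringI)
  show "abelian_group (fps_ring S)"
    using S_uminus by (intro abelian_groupI) (auto simp: fps_ring_def S_0 S_add ac_simps intro!: bexI[of _ "- _"])
  show "comm_monoid (fps_ring S)"
    by (rule comm_monoidI) (auto simp: fps_ring_def S_1 S_mult ac_simps)
qed (simp add: fps_ring_def distrib_right)

section \<open>Counting unknowns against linear conditions\<close>

context mps_curve_torsion_free
begin

text \<open>\<open>m5\<close> says that the fifth power of the maximal ideal is spanned by one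
  element modulo x_1, and \<open>socle\<close> that the socle is spanned by \<open>r\<close>
  elements. If the bound failed, the linear system would have a nonzero solution, and interpreting
  its equations shows every unknown to be zero.\<close>

lemma type_bound:
  fixes s b :: "nat \<Rightarrow> 'k fps"
  assumes m5: "\<And>F. F \<in> mps_carrier n \<Longrightarrow> (\<And>d. size d < 5 \<Longrightarrow> F d = 0) \<Longrightarrow>
      \<exists>c. ev F - (\<Sum>i<1. fps_const (c i) * s i) \<in> (*) (x 1) ` S"
    and socle: "\<And>a. a \<in> S \<Longrightarrow> (\<And>i. i \<in> {1..n} \<Longrightarrow> a * x i \<in> (*) (x 1) ` S) \<Longrightarrow>
      \<exists>c. a - (\<Sum>i<r. fps_const (c i) * b i) \<in> (*) (x 1) ` S"
  shows "(n - 1) choose 2 \<le> (n - 1) + r"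
proof (rule ccontr)
  assume contr: "\<not> (n - 1) choose 2 \<le> (n - 1) + r"
  obtain N where N: "\<And>g. (\<forall>k<N. g $ k = 0) \<Longrightarrow> g \<in> S"
    using conductor_exponent by blast
  define D where "D = {y. \<exists>g. (\<forall>i\<in>{1..n}. g i \<in> S) \<and> y = (\<Sum>i\<in>{1..n}. g i * fps_XD (x i))}"
  have x1: "x 1 \<in> S"
    using S_x n_pos by simp
  have D_add: "v + w \<in> D" if vw: "v \<in> D" "w \<in> D" for v w
  proof -
    obtain g h where "\<forall>i\<in>{1..n}. g i \<in> S" "v = (\<Sum>i\<in>{1..n}. g i * fps_XD (x i))"
      "\<forall>i\<in>{1..n}. h i \<in> S" "w = (\<Sum>i\<in>{1..n}. h i * fps_XD (x i))"
      using vw unfolding D_def by blast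
    then show ?thesis
      unfolding D_def by (intro CollectI exI[of _ "\<lambda>i. g i + h i"])
        (auto simp: distrib_right sum.distrib intro: S_add)
  qed
  have D_mult: "s * v \<in> D" if v: "v \<in> D" and s: "s \<in> S" for v s
  proof -
    obtain g where "\<forall>i\<in>{1..n}. g i \<in> S" "v = (\<Sum>i\<in>{1..n}. g i * fps_XD (x i))"
      using v unfolding D_def by blast
    then show ?thesis
      unfolding D_def using s by (intro CollectI exI[of _ "\<lambda>i. s * g i"])
        (auto simp: sum_distrib_left mult.assoc intro: S_mult)
  qed
  have D_XD: "fps_XD s \<in> D" if s: "s \<in> S" for s
  proof -
    obtain F where "F \<in> mps_carrier n" "ev F = s"
      using lift s by blast
    then show ?thesis
      unfolding D_def using XD_ev[of F] grad_closed[of F] by blast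
  qed
  have D_sum: "sum v A \<in> D" if "\<And>k. k \<in> A \<Longrightarrow> v k \<in> D" for v and A :: "((nat \<times> nat) + nat) set"
  proof -
    have "0 \<in> D"
      using D_mult[OF D_XD[OF S_0] S_0] by simp
    with that show ?thesis
      by (induction A rule: infinite_finite_induct) (auto intro: D_add)
  qed
  have D_uminus: "- v \<in> D" if "v \<in> D" for v
    using D_mult[OF that S_uminus[OF S_1]] by simp
  have D_0: "y $ 0 = 0" if "y \<in> D" for y
    using that unfolding D_def by (auto simp: fps_sum_nth)
  \<comment> \<open>Integration: in characteristic 0, \<open>g\<close> is \<delta> of the series
    with coefficients divided by their exponents. \<open>Suc N\<close> ensures a zero constant term
    even for N = 0.\<close>
  have D_conductor: "g \<in> D" if "\<forall>k<Suc N. g $ k = 0" for g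
  proof -
    define h where "h = Abs_fps (\<lambda>k. g $ k / of_nat k)"
    have "h \<in> S"
      using that by (intro N) (simp add: h_def)
    moreover have "fps_XD h = g"
      using that by (intro fps_ext) (simp add: h_def)
    ultimately show ?thesis
      using D_XD by blast
  qed
  have D_shift: "fps_X ^ e * w \<in> D" if "w \<in> D" for w
    using D_mult[OF that x1] unfolding x_1 .
  \<comment> \<open>For \<open>D\<close> the spanning property is kept, bounding the number of
    equations; for \<open>S\<close> independence is kept, so that the \<open>e\<close> unknowns are
    genuine.\<close>
  obtain d where d_span: "\<forall>y\<in>D. \<exists>c. y - (\<Sum>j<e. fps_const (c j) * d j) \<in> (*) (fps_X ^ e) ` D"
    using apery_basis[where N = "Suc N", OF e_pos D_add D_mult[OF _ S_const] D_shift D_conductor] by blast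
  obtain u where u: "\<forall>j<e. u j \<in> S \<and> (\<forall>k<j. u j $ k = 0)"
    "\<forall>c. (\<Sum>j<e. fps_const (c j) * u j) \<in> (*) (fps_X ^ e) ` S \<longrightarrow> (\<forall>j<e. c j = 0)"
    using apery_basis[where N = N, OF e_pos S_add S_mult[OF S_const] S_mult[OF x1[unfolded x_1]] N] by blast
  let ?W = "(*) (x 1) ` S"
  have W: "0 \<in> ?W" "\<And>v w. v \<in> ?W \<Longrightarrow> w \<in> ?W \<Longrightarrow> v + w \<in> ?W" "\<And>t w. w \<in> ?W \<Longrightarrow> t \<in> S \<Longrightarrow> t * w \<in> ?W"
  proof -
    show "0 \<in> ?W"
      using S_0 by (intro image_eqI[of _ _ 0]) auto
    show "v + w \<in> ?W" if "v \<in> ?W" "w \<in> ?W" for v w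
      using that S_add by (auto simp flip: distrib_left)
    show "t * w \<in> ?W" if "w \<in> ?W" "t \<in> S" for t w
      using that S_mult by (auto simp: mult.left_commute)
  qed
  have W_subspace: "fps_vs.subspace ?W"
    using W S_const by (auto simp: fps_vs.subspace_def)
  have D_subspace: "fps_vs.subspace ((*) (x 1) ` D)"
    unfolding fps_vs.subspace_def
  proof (intro conjI ballI allI)
    show "0 \<in> (*) (x 1) ` D"
      using D_mult[OF D_XD[OF S_0] S_0] by (intro image_eqI[of _ _ 0]) auto
    show "v + w \<in> (*) (x 1) ` D" if "v \<in> (*) (x 1) ` D" "w \<in> (*) (x 1) ` D" for v w
      using that D_add by (auto simp flip: distrib_left)
    show "fps_const c * w \<in> (*) (x 1) ` D" if "w \<in> (*) (x 1) ` D" for c w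
      using that D_mult[OF _ S_const] by (auto simp: mult.left_commute)
  qed
  obtain \<phi> :: "nat \<Rightarrow> 'k fps \<Rightarrow> 'k" where \<phi>:
    "\<forall>i A c Z. \<phi> i (\<Sum>k\<in>A. fps_const (c k) * Z k) = (\<Sum>k\<in>A. \<phi> i (Z (k :: (nat \<times> nat) + nat)) * c k)"
    "\<forall>y c. y - (\<Sum>i<e. fps_const (c i) * d i) \<in> (*) (x 1) ` D \<longrightarrow> (\<forall>i<e. \<phi> i y = 0) \<longrightarrow> y \<in> (*) (x 1) ` D"
    using fps_functionals[where b = d and d = e, OF D_subspace] by (elim exE conjE) (rule that)
  obtain \<chi> :: "nat \<Rightarrow> 'k fps \<Rightarrow> 'k" where \<chi>:
    "\<forall>i A c Z. \<chi> i (\<Sum>k\<in>A. fps_const (c k) * Z k) = (\<Sum>k\<in>A. \<chi> i (Z (k :: (nat \<times> nat) + nat)) * c k)"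
    "\<forall>y c. y - (\<Sum>i<1. fps_const (c i) * s i) \<in> ?W \<longrightarrow> (\<forall>i<1. \<chi> i y = 0) \<longrightarrow> y \<in> ?W"
    using fps_functionals[where b = s and d = 1, OF W_subspace] by (elim exE conjE) (rule that)
  obtain \<sigma> :: "nat \<Rightarrow> 'k fps \<Rightarrow> 'k" where \<sigma>:
    "\<forall>i A c Z. \<sigma> i (\<Sum>k\<in>A. fps_const (c k) * Z k) = (\<Sum>k\<in>A. \<sigma> i (Z (k :: (nat \<times> nat) + nat)) * c k)"
    "\<forall>y c. y - (\<Sum>i<r. fps_const (c i) * b i) \<in> ?W \<longrightarrow> (\<forall>i<r. \<sigma> i y = 0) \<longrightarrow> y \<in> ?W"
    using fps_functionals[where b = b and d = r, OF W_subspace] by (elim exE conjE) (rule that)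
  note lin = \<phi>(1)[rule_format] \<chi>(1)[rule_format] \<sigma>(1)[rule_format]
  define P where "P = (SIGMA j:{2..n}. {2..<j})"
  define J where "J = P <+> {..<e}"
  define I where "I = {..<e} <+> ({2..n} <+> {..<r})"
  \<comment> \<open>\<open>h\<close> must have zero constant term, so it is built from the
    \<open>u q\<close> with q \<ge> 1. The free slot q = 0 carries \<delta>x_1, which keeps the
    number of unknowns at \<open>e\<close>.\<close>
  define Z where "Z k = (case k of Inl (j, i) \<Rightarrow> x i * fps_XD (x j)
    | Inr q \<Rightarrow> - fps_XD (if q = 0 then x 1 else u q))" for k
  define U where "U k = (case k of Inl (j, i) \<Rightarrow> 0 | Inr q \<Rightarrow> if q = 0 then 0 else u q)"
    for k :: "(nat \<times> nat) + nat"
  \<comment> \<open>Three blocks of equations: the \<phi> for the whole combination \<open>Y\<close>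
    modulo x_1D, one \<chi> for each product of \<open>h\<close> with x_2, ..., x_n, and the
    \<sigma> for \<open>h\<close> itself modulo x_1.\<close>
  define M where "M i k = (case i of Inl q \<Rightarrow> \<phi> q (Z k)
    | Inr (Inl i) \<Rightarrow> \<chi> 0 (x i * U k) | Inr (Inr l) \<Rightarrow> \<sigma> l (U k))" for i k
  have fin: "finite P" "finite J" "finite I"
    by (simp_all add: P_def J_def I_def)
  have "card P = (n - 1) choose 2"
    unfolding P_def using n_pos by (rule card_triangle)
  then have "card I < card J"
    using contr fin by (simp add: I_def J_def card_Plus)
  from underdetermined_system[OF fin(3,2) this, of M]
  obtain c where c: "\<exists>k\<in>J. c k \<noteq> 0" "\<And>i. i \<in> I \<Longrightarrow> (\<Sum>k\<in>J. M i k * c k) = 0"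
    by blast
  define Y where "Y = (\<Sum>k\<in>J. fps_const (c k) * Z k)"
  define h where "h = (\<Sum>k\<in>J. fps_const (c k) * U k)"
  define T where "T = (\<Sum>(j, i)\<in>P. fps_const (c (Inl (j, i))) * (x i * fps_XD (x j)))"
  define c' where "c' q = (if q = 0 then 0 else c (Inr q))" for q
  have U_S: "U k \<in> S" if "k \<in> J" for k
    using that u(1) S_0 by (auto simp: J_def U_def)
  have h_S: "h \<in> S"
    unfolding h_def by (intro S_sum S_mult S_const U_S)
  have h_u: "h = (\<Sum>q<e. fps_const (c' q) * u q)"
    unfolding h_def J_def using fin(1)
    by (auto simp: sum.Plus U_def c'_def case_prod_unfold intro!: sum.cong)
  have h_0: "h $ 0 = 0"
    unfolding h_u fps_sum_nth using u(1) by (auto simp: c'_def intro!: sum.neutral)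
  have Y_eq: "Y = T - fps_XD h - fps_const (c (Inr 0)) * fps_XD (x 1)"
  proof -
    have "Y = T + (\<Sum>q<e. fps_const (c (Inr q)) * Z (Inr q))"
      unfolding Y_def J_def T_def using fin(1) by (simp add: sum.Plus Z_def case_prod_unfold)
    also have "(\<Sum>q<e. fps_const (c (Inr q)) * Z (Inr q)) =
      (\<Sum>q<e. - fps_XD (fps_const (c' q) * u q) - (if q = 0 then fps_const (c (Inr 0)) * fps_XD (x 1) else 0))"
      by (rule sum.cong) (auto simp: Z_def c'_def fps_XD_def)
    also have "\<dots> = - fps_XD h - fps_const (c (Inr 0)) * fps_XD (x 1)"
    proof -
      have "fps_XD h = (\<Sum>q<e. fps_XD (fps_const (c' q) * u q))"
        unfolding h_u by (intro fps_ext) (simp add: fps_sum_nth sum_distrib_left mult.left_commute)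
      then show ?thesis
        using e_pos by (simp add: sum_subtractf sum_negf)
    qed
    finally show ?thesis
      by simp
  qed
  have "Y \<in> D"
    unfolding Y_def
  proof (intro D_sum D_mult S_const)
    fix k assume "k \<in> J"
    then show "Z k \<in> D"
      using S_x u(1) x1 by (auto simp: J_def P_def Z_def intro!: D_mult D_XD D_uminus)
  qed
  moreover have "\<forall>q<e. \<phi> q Y = 0"
    using c(2)[of "Inl _"] unfolding Y_def lin by (auto simp: I_def M_def)
  ultimately have "Y \<in> (*) (x 1) ` D"
    using d_span \<phi>(2) unfolding x_1 by blast
  then obtain g where g: "\<forall>i\<in>{1..n}. g i \<in> S" "Y = x 1 * (\<Sum>i\<in>{1..n}. g i * fps_XD (x i))"
    unfolding D_def by blast
  define \<Lambda> where "\<Lambda> i j = c (Inl (j, i))" for i j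
  have T_eq: "T = (\<Sum>j\<in>{1..n}. (\<Sum>i\<in>{2..<j}. fps_const (\<Lambda> i j) * x i) * fps_XD (x j))"
  proof -
    have "T = (\<Sum>j\<in>{2..n}. \<Sum>i\<in>{2..<j}. fps_const (\<Lambda> i j) * (x i * fps_XD (x j)))"
      unfolding T_def P_def \<Lambda>_def by (subst sum.Sigma) auto
    also have "\<dots> = (\<Sum>j\<in>{1..n}. (\<Sum>i\<in>{2..<j}. fps_const (\<Lambda> i j) * x i) * fps_XD (x j))"
      by (rule sum.mono_neutral_cong_left) (auto simp: sum_distrib_right mult.assoc intro!: sum.neutral)
    finally show ?thesis .
  qed
  have eq: "(\<Sum>j\<in>{1..n}. (\<Sum>i\<in>{2..<j}. fps_const (\<Lambda> i j) * x i) * fps_XD (x j)) =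
    fps_XD h + x 1 * (\<Sum>i\<in>{1..n}. g i * fps_XD (x i)) + fps_const (c (Inr 0)) * fps_XD (x 1)"
    using Y_eq unfolding T_eq[symmetric] g(2)[symmetric] by simp
  note exact = exact_combination[OF h_S h_0 _ S_const eq]
  have \<Lambda>: "c (Inl (j, i)) = 0" if "(j, i) \<in> P" for i j
    using exact(1)[of j i] that g(1) by (auto simp: P_def \<Lambda>_def)
  obtain F t where F: "F \<in> mps_carrier n" "\<And>d. size d < 4 \<Longrightarrow> F d = 0" and t: "t \<in> S" "h = ev F + x 1 * t"
    using exact(2) g(1) by blast
  \<comment> \<open>For i = 1 this is automatic, so only n - 1 equations are spent. Otherwise
    multiplication by X_i raises the order of \<open>F\<close> from four to five and
    \<open>m5\<close> applies.\<close>
  have xh: "h * x i \<in> ?W" if i: "i \<in> {1..n}" for i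
  proof (cases "i = 1")
    case True
    then show ?thesis
      using h_S by (auto simp: mult.commute)
  next
    case False
    define F' where "F' = mps_mult (mps_var i) F"
    have F': "F' \<in> mps_carrier n" "ev F' = x i * ev F"
      using mps_mult_closed[OF mps_var_carrier[OF i] F(1)] ev_var[OF i] by (simp_all add: F'_def ev_mult)
    have "F' d = 0" if "size d < 5" for d
      unfolding F'_def mps_mult_var using that F(2) by (auto simp: size_Diff_singleton)
    then obtain k where "ev F' - (\<Sum>l<1. fps_const (k l) * s l) \<in> ?W"
      using m5[OF F'(1)] by blast
    moreover have "x i * (x 1 * t) \<in> ?W"
      by (rule W(3)[OF imageI[OF t(1)] S_x[OF i]])
    ultimately have "(ev F' - (\<Sum>l<1. fps_const (k l) * s l)) + x i * (x 1 * t) \<in> ?W"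
      by (rule W(2))
    also have "(ev F' - (\<Sum>l<1. fps_const (k l) * s l)) + x i * (x 1 * t) =
        x i * h - (\<Sum>l<1. fps_const (k l) * s l)"
      by (simp add: F'(2) t(2) algebra_simps)
    finally have "x i * h - (\<Sum>l<1. fps_const (k l) * s l) \<in> ?W" .
    moreover have "\<chi> 0 (x i * h) = 0"
    proof -
      have "x i * h = (\<Sum>k\<in>J. fps_const (c k) * (x i * U k))"
        by (simp add: h_def sum_distrib_left mult.left_commute)
      moreover have "i \<in> {2..n}"
        using i False by auto
      then have "Inr (Inl i) \<in> I"
        unfolding I_def by (intro InrI InlI)
      ultimately show ?thesis
        using c(2) by (fastforce simp: lin M_def)
    qed
    ultimately show ?thesis
      using \<chi>(2) by (auto simp: mult.commute)
  qed
  obtain k where "h - (\<Sum>i<r. fps_const (k i) * b i) \<in> ?W"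
    using socle[OF h_S xh] by blast
  moreover have "\<forall>l<r. \<sigma> l h = 0"
    using c(2)[of "Inr (Inr _)"] unfolding h_def lin by (auto simp: I_def M_def)
  ultimately have "h \<in> ?W"
    using \<sigma>(2) by blast
  then have c'_0: "\<forall>q<e. c' q = 0"
    using u(2) unfolding h_u x_1 by blast
  then have "h = 0"
    unfolding h_u by simp
  define y where "y = (\<Sum>i\<in>{1..n}. g i * fps_XD (x i))"
  have "y \<in> D"
    unfolding y_def D_def using g(1) by blast
  have "T = 0"
    unfolding T_def using \<Lambda> by (intro sum.neutral) auto
  then have "fps_X ^ e * y + fps_const (c (Inr 0)) * fps_XD (x 1) = 0"
    using eq unfolding T_eq[symmetric] y_def[symmetric] \<open>h = 0\<close> x_1 by (simp add: fps_XD_def)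
  \<comment> \<open>At t^e only the second summand survives, as \<open>y\<close> has no constant
    term; it contributes \<open>e\<close> times the last unknown.\<close>
  then have "(fps_X ^ e * y + fps_const (c (Inr 0)) * fps_XD (fps_X ^ e)) $ e = 0"
    unfolding x_1 by simp
  then have c_0: "c (Inr 0) = 0"
    using D_0[OF \<open>y \<in> D\<close>] e_pos by (simp add: fps_X_power_mult_nth fps_X_power_nth)
  have "c k = 0" if "k \<in> J" for k
    using that unfolding J_def
  proof (elim PlusE)
    fix p assume "p \<in> P" "k = Inl p"
    then show "c k = 0"
      using \<Lambda> by (cases p) auto
  next
    fix q assume "q \<in> {..<e}" "k = Inr q"
    then show "c k = 0"
      using c'_0 c_0 by (cases "q = 0") (auto simp: c'_def)
  qed
  with c(1) show False
    by blast
qed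

end

section \<open>From the ring-theoretic hypotheses to the parametrized curve\<close>

lemma fps_const_X_multiple: "fps_const c * fps_X = fps_const (d :: 'k::field) \<Longrightarrow> c = 0"
  by (drule arg_cong[of _ _ "\<lambda>f. f $ 1"]) simp

theorem corollary5p8:
  fixes S \<mm> :: "'k::{alg_closed_field, field_char_0} fps set"
    and n m r :: nat
    and x \<alpha> :: "nat \<Rightarrow> 'k fps"
    and a :: "nat \<Rightarrow> nat"
    and f :: "nat \<Rightarrow> 'k mps"
  assumes "complete_local_curve S \<mm>"
    and "embedding_dim S \<mm> n"
    and "x ` {1..n} \<subseteq> S" and "\<mm> = Idl\<^bsub>fps_ring S\<^esub> (x ` {1..n})"
    and "\<And>i. i \<in> {1..n} \<Longrightarrow> x i = \<alpha> i * fps_X ^ a i"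
    and "\<And>i. i \<in> {1..n} \<Longrightarrow> \<alpha> i dvd 1" and "\<alpha> 1 = 1"
    and "mono_on {1..n} a"
    and "presentation S n x m f"
    and "conductor S \<subseteq> ideal_pow (fps_ring S) \<mm> 2"
    and "quotient_dim S (Idl\<^bsub>fps_ring S\<^esub> (insert (x 1) (conductor S))) (PIdl\<^bsub>fps_ring S\<^esub> (x 1)) 1"
    and "cm_type S \<mm> r"
    and "int r \<le> int (n choose 2) - 2 * int n"
    and "ideal_pow (fps_ring S) \<mm> 5 \<subseteq> conductor S <+>\<^bsub>fps_ring S\<^esub> PIdl\<^bsub>fps_ring S\<^esub> (x 1)"
  shows "torsion (fps_ring S) (differentials S n x m f) \<noteq> {\<zero>\<^bsub>differentials S n x m f\<^esub>}"
proof
  assume torsion: "torsion (fps_ring S) (differentials S n x m f) = {\<zero>\<^bsub>differentials S n x m f\<^esub>}"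
  note x_S = assms(3) and \<mm> = assms(4) and x_eq = assms(5)
  have closure: "integral_closure S = range fps_to_fls" and const: "range fps_const \<subseteq> S"
    and local: "local_with (fps_ring S) \<mm>"
    using assms(1) by (auto simp: complete_local_curve_def)
  have carrier: "carrier (mps_ring n) = (mps_carrier n :: 'k mps set)"
    by (simp add: mps_ring_def)
  have image: "mps_eval n x ` mps_carrier n = S"
    and f_carrier: "f ` {1..m} \<subseteq> mps_carrier n"
    and kernel: "Idl\<^bsub>mps_ring n\<^esub> (f ` {1..m}) = {F \<in> mps_carrier n. mps_eval n x F = 0}"
    and order: "Idl\<^bsub>mps_ring n\<^esub> (f ` {1..m}) \<subseteq>
       ideal_pow (mps_ring n) (Idl\<^bsub>mps_ring n\<^esub> (mps_var ` {1..n})) 2"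
    using assms(9) by (auto simp: presentation_def carrier a_kernel_def' fps_ring_def)
  have frac: "\<exists>q\<in>S. q \<noteq> 0 \<and> q * fps_X \<in> S"
  proof -
    have "fps_to_fls fps_X \<in> frac_field S"
      using closure unfolding integral_closure_def by blast
    then obtain p q where pq: "p \<in> S" "q \<in> S" "q \<noteq> 0" "fps_to_fls fps_X = fps_to_fls p / fps_to_fls q"
      unfolding frac_field_def by blast
    have "fps_to_fls (q * fps_X) = fps_to_fls p"
      unfolding fls_times_fps_to_fls pq(4) using pq(3) by simp
    then have "q * fps_X = p"
      by (simp only: fps_to_fls_eq_iff)
    with pq show ?thesis
      by blast
  qed
  \<comment> \<open>Without variables \<open>S\<close> would consist of constants, and t could not
    be a quotient of elements of \<open>S\<close>.\<close>
  have n_pos: "1 \<le> n"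
  proof (rule ccontr)
    assume "\<not> 1 \<le> n"
    then have n: "n = 0"
      by simp
    have "s = fps_const (s $ 0)" if s: "s \<in> S" for s
    proof -
      interpret mps_evaluation n x
        by unfold_locales (use n in simp)
      obtain F where F: "F \<in> mps_carrier n" "ev F = s"
        using s image by blast
      have "F = (\<lambda>d. if d = {#} then F {#} else 0)"
        using F(1) n by fastforce
      then show ?thesis
        using ev_const[of "F {#}"] F(2) by simp
    qed
    with frac show False
      by (metis fps_const_X_multiple fps_const_0_eq_0)
  qed
  then have x1: "x 1 = fps_X ^ a 1"
    using x_eq[of 1] assms(7) by simp
  have max: "maximalideal \<mm> (fps_ring S)"
    using local by (simp add: local_with_def)
  have x1_in: "x 1 \<in> \<mm>"
  proof -
    interpret ideal \<mm> "fps_ring S"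
      using max by (rule maximalideal.axioms(1))
    show ?thesis
      unfolding \<mm> using genideal_self[of "x ` {1..n}"] x_S n_pos by (auto simp: fps_ring_def)
  qed
  \<comment> \<open>If \<open>a 1\<close> were 0, then x_1 would be 1 and the maximal ideal the
    whole ring; the other exponents follow by monotonicity.\<close>
  have a_pos: "1 \<le> a i" if i: "i \<in> {1..n}" for i
  proof -
    have "a 1 \<noteq> 0"
    proof
      assume "a 1 = 0"
      then have "\<one>\<^bsub>fps_ring S\<^esub> \<in> \<mm>"
        using x1 x1_in by (simp add: fps_ring_def)
      then show False
        using ideal.one_imp_carrier[OF maximalideal.axioms(1)[OF max]] maximalideal.I_notcarr[OF max]
        by simp
    qed
    moreover have "a 1 \<le> a i"
      using assms(8) i n_pos by (auto simp: mono_on_def)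
    ultimately show ?thesis
      by simp
  qed
  interpret mps_curve n x S m "a 1" f
  proof unfold_locales
    show "x i $ 0 = 0" if "i \<in> {1..n}" for i
      using x_eq[OF that] a_pos[OF that] by (simp add: fps_X_power_mult_right_nth)
    show "F d = 0" if "F \<in> mps_carrier n" "mps_eval n x F = 0" "size d < 2" for F d
      using that order kernel by (intro mps_order_two[of F n d]) auto
    show "f j \<in> mps_carrier n" "mps_eval n x (f j) = 0" if "j \<in> {1..m}" for j
      using that f_carrier kernel ring.genideal_self[OF cring.axioms(1)[OF cring_mps_ring], of "f ` {1..m}" n]
      unfolding carrier by blast+
    show "F \<in> Idl\<^bsub>mps_ring n\<^esub> (f ` {1..m})" if "F \<in> mps_carrier n" "mps_eval n x F = 0" for F
      using that kernel by blast
  qed (use n_pos a_pos x1 image frac in auto)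
  interpret R: cring "fps_ring S"
    by (rule cring_fps_ring)
  interpret mps_curve_torsion_free n x S m "a 1" f
  proof unfold_locales
    fix v assume v: "\<And>i. i \<in> {1..n} \<Longrightarrow> v i \<in> S" "(\<Sum>i\<in>{1..n}. v i * fps_XD (x i)) = 0"
    obtain r where r: "r \<in> S" "r \<noteq> 0" "(\<lambda>i. r * v i) \<in> rels"
      using syzygy_torsion[OF v] by blast
    show "v \<in> rels"
      by (rule torsion_free_rels[OF torsion _ r]) (rule v(1))
  qed
  let ?W = "(*) (x 1) ` S"
  have simps: "carrier (fps_ring S) = S" "s \<otimes>\<^bsub>fps_ring S\<^esub> t = s * t" "s \<oplus>\<^bsub>fps_ring S\<^esub> t = s + t"
    "\<zero>\<^bsub>fps_ring S\<^esub> = 0" for s t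
    by (simp_all add: fps_ring_def)
  have x1_S: "x 1 \<in> S"
    using S_x n_pos by simp
  have W: "PIdl\<^bsub>fps_ring S\<^esub> (x 1) = ?W"
    by (auto simp: cgenideal_def simps mult.commute)
  have W_ideal: "ideal ?W (fps_ring S)"
    using R.cgenideal_ideal[of "x 1"] x1_S unfolding W by (simp add: simps)
  have conductor: "conductor S \<subseteq> S"
  proof
    fix q assume "q \<in> conductor S"
    then have "fps_to_fls q * fps_to_fls 1 \<in> fps_to_fls ` S"
      unfolding conductor_def using closure by blast
    then show "q \<in> S"
      by auto
  qed
  define K where "K = Idl\<^bsub>fps_ring S\<^esub> (insert (x 1) (conductor S))"
  have gen: "insert (x 1) (conductor S) \<subseteq> carrier (fps_ring S)"
    using conductor x1_S by (simp add: simps)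
  interpret K: ideal K "fps_ring S"
    unfolding K_def by (rule R.genideal_ideal[OF gen])
  have K: "insert (x 1) (conductor S) \<subseteq> K"
    unfolding K_def by (rule R.genideal_self[OF gen])
  have K_S: "K \<subseteq> S"
    using K.a_subset by (simp add: simps)
  have K_dim: "quotient_dim S K ?W 1"
    using assms(11) unfolding W K_def .
  obtain s :: "nat \<Rightarrow> 'k fps" where s: "\<forall>y\<in>K. \<exists>c. y - (\<Sum>i<1. fps_const (c i) * s i) \<in> ?W"
    using quotient_dim_spanning[OF W_ideal K_S const K_dim] by (rule exE)
  \<comment> \<open>The type is evaluated at the parameter x_1, so that the socle and the conductor
    are measured modulo the same ideal.\<close>
  define soc where "soc = {a \<in> S. \<forall>b\<in>\<mm>. a * b \<in> ?W}"
  have "x 1 \<noteq> 0"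
    using x1 by simp
  then have soc_dim: "quotient_dim S soc ?W r"
    using assms(12) x1_in unfolding cm_type_def soc_def W[symmetric] by blast
  have soc_S: "soc \<subseteq> S"
    by (auto simp: soc_def)
  obtain b where b: "\<forall>y\<in>soc. \<exists>c. y - (\<Sum>i<r. fps_const (c i) * b i) \<in> ?W"
    using quotient_dim_spanning[OF W_ideal soc_S const soc_dim] by (rule exE)
  have "(n - 1) choose 2 \<le> (n - 1) + r"
  proof (rule type_bound)
    fix F assume F: "F \<in> mps_carrier n" "\<And>d. size d < 5 \<Longrightarrow> F d = (0 :: 'k)"
    have "x ` {1..n} \<subseteq> \<mm>"
      unfolding \<mm> using R.genideal_self[of "x ` {1..n}"] x_S by (simp add: simps)
    then have "ev F \<in> ideal_pow (fps_ring S) \<mm> 5"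
      using F by (intro ev_ideal_pow) auto
    then have "ev F \<in> conductor S <+>\<^bsub>fps_ring S\<^esub> ?W"
      using assms(14) unfolding W by blast
    then obtain p q where "p \<in> conductor S" "q \<in> ?W" "ev F = p + q"
      by (auto simp: set_add_def' simps)
    moreover from this have "q \<in> K"
      using K K.I_r_closed[of "x 1"] by (auto simp: simps)
    ultimately have "ev F \<in> K"
      using K K.a_closed[of p q] by (auto simp: simps)
    then show "\<exists>c. ev F - (\<Sum>i<1. fps_const (c i) * s i) \<in> ?W"
      using s by blast
  next
    fix h assume h: "h \<in> S" "\<And>i. i \<in> {1..n} \<Longrightarrow> h * x i \<in> ?W"
    interpret W: ideal ?W "fps_ring S"
      by (rule W_ideal)
    \<comment> \<open>As the elements carrying \<open>h\<close> into \<open>?W\<close> form an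
      ideal, testing the generators \<open>x i\<close> of \<mm> suffices.\<close>
    have "ideal {b \<in> S. h * b \<in> ?W} (fps_ring S)"
    proof (rule R.idealI')
      show "u \<oplus>\<^bsub>fps_ring S\<^esub> v \<in> {b \<in> S. h * b \<in> ?W}"
        if "u \<in> {b \<in> S. h * b \<in> ?W}" "v \<in> {b \<in> S. h * b \<in> ?W}" for u v
        using that W.a_closed[of "h * u" "h * v"] S_add by (simp add: simps distrib_left)
      show "v \<otimes>\<^bsub>fps_ring S\<^esub> u \<in> {b \<in> S. h * b \<in> ?W}"
        if "u \<in> {b \<in> S. h * b \<in> ?W}" "v \<in> carrier (fps_ring S)" for u v
        using that W.I_l_closed[of "h * u" v] S_mult by (simp add: simps mult.left_commute)
    qed (use S_0 in \<open>auto simp: simps intro: image_eqI[of _ _ 0]\<close>)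
    then have "\<mm> \<subseteq> {b \<in> S. h * b \<in> ?W}"
      unfolding \<mm> by (rule R.genideal_minimal) (use h(2) x_S in auto)
    then have "h \<in> soc"
      using h(1) unfolding soc_def by blast
    then show "\<exists>c. h - (\<Sum>i<r. fps_const (c i) * b i) \<in> ?W"
      using b by blast
  qed
  moreover have "n choose 2 = ((n - 1) choose 2) + (n - 1)"
    using n_pos by (cases n) (auto simp: numeral_2_eq_2)
  ultimately show False
    using assms(13) n_pos by linarith
qed

end
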